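(* Let $f(\mathbf z)$ be a convenient non-degenerate analytic function in a neighborhood of the origin of $\mathbb C^n$ with $f(\mathbf 0)=0$. For $1\le j\le n$ let $z_j^{b_j}$ be the monomial corresponding to the point of the Newton boundary $\Gamma(f)$ on the $j$-th coordinate axis, and let $B=\max\{b_1,\dots,b_n\}$. Then $\theta_0(f)\le 1-1/B$. Furthermore, if there exists a non-exceptional Łojasiewicz monomial of $f$, then the equality $\theta_0(f)=1-1/B$ holds.
   Context: Łojasiewicz exponent: $\partial f=(\partial f/\partial z_1,\dots,\partial f/\partial z_n)$, and $\theta_0(f)$ is the infimum of all $\theta\in[0,1)$ for which there exist $c>0$ and a neighborhood $U$ of $\mathbf 0$ with $\|\partial f(\mathbf z)\|\ge c|f(\mathbf z)|^\theta$ for all $\mathbf z\in U$. Write $f(\mathbf z)=\sum_\nu c_\nu\mathbf z^\nu$. $\Gamma_+(f)$ is the convex hull of $\bigcup_{c_\nu\ne0}(\nu+\mathbb R_+^n)$, and the Newton boundary $\Gamma(f)$ is the union of compact faces of $\Gamma_+(f)$. For a strictly positive weight vector $P=(p_1,\dots,p_n)$ (all $p_i>0$), $\Delta(P)$ is the face of $\Gamma_+(f)$ where $\nu\mapsto\sum_i p_i\nu_i$ is minimal and $f_P(\mathbf z)=\sum_{\nu\in\Delta(P)}c_\nu\mathbf z^\nu$. $f$ is non-degenerate if $f_P:\mathbb C^{*n}\to\mathbb C$ has no critical point for every strictly positive $P$, where $\mathbb C^{*n}=\{\mathbf z\mid z_i\ne0\ \forall i\}$. $f$ is convenient if for every nonempty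 $I\subset\{1,\dots,n\}$ the restriction of $f$ to $\{z_j=0,\ j\notin I\}$ is not identically zero; equivalently, $\Gamma(f)$ meets each coordinate axis. The monomial $z_j^{b_j}$ is called a Łojasiewicz monomial if $b_j=B$. It is exceptional if moreover there exist $k\neq j$ and a monomial $z_j^{B'}z_k$ appearing in $f(\mathbf z)$ (with non-zero coefficient) with $B'<B-1$. Otherwise a Łojasiewicz monomial is called non-exceptional. *)

theory Defs
  imports "HOL-Analysis.Analysis"
begin

definition zmonom :: "nat ^ 'n \<Rightarrow> complex ^ 'n \<Rightarrow> complex" where
  "zmonom \<nu> z = (\<Prod>i\<in>UNIV. z $ i ^ (\<nu> $ i))"

text \<open>
  A function is analytic near the origin, with Taylor coefficients \<open>c\<close>, if its multiple power
  series converges (unconditionally, hence absolutely) to it on some ball around the origin.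
\<close>

definition has_power_series_at_0 ::
    "(complex ^ 'n \<Rightarrow> complex) \<Rightarrow> (nat ^ 'n \<Rightarrow> complex) \<Rightarrow> bool" where
  "has_power_series_at_0 f c \<longleftrightarrow>
     (\<exists>r>0. \<forall>z\<in>ball 0 r. ((\<lambda>\<nu>. c \<nu> * zmonom \<nu> z) has_sum f z) UNIV)"

definition partial_deriv ::
    "'n \<Rightarrow> (complex ^ 'n \<Rightarrow> complex) \<Rightarrow> complex ^ 'n \<Rightarrow> complex" where
  "partial_deriv i f z = deriv (\<lambda>w. f (z + axis i w)) 0"

definition gradient :: "(complex ^ 'n \<Rightarrow> complex) \<Rightarrow> complex ^ 'n \<Rightarrow> complex ^ 'n" where
  "gradient f z = (\<chi> i. partial_deriv i f z)"

text \<open>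
  The case distinction implements \<open>0\<^sup>0 = 1\<close>, whereas \<open>0 powr 0 = 0\<close> in the library.
\<close>

definition lojasiewicz_ineq :: "(complex ^ 'n \<Rightarrow> complex) \<Rightarrow> real \<Rightarrow> bool" where
  "lojasiewicz_ineq f \<theta> \<longleftrightarrow>
     (\<exists>C>0. \<exists>U. open U \<and> 0 \<in> U \<and>
        (\<forall>z\<in>U. norm (gradient f z) \<ge> C * (if \<theta> = 0 then 1 else norm (f z) powr \<theta>)))"

text \<open>
  The infimum is taken in the extended reals, so that it would be \<open>\<infinity>\<close> if no exponent were admissible.
\<close>

definition lojasiewicz_exponent :: "(complex ^ 'n \<Rightarrow> complex) \<Rightarrow> ereal" where
  "lojasiewicz_exponent f = (INF \<theta>\<in>{\<theta>. 0 \<le> \<theta> \<and> \<theta> < 1 \<and> lojasiewicz_ineq f \<theta>}. ereal \<theta>)"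

definition real_vec :: "nat ^ 'n \<Rightarrow> real ^ 'n" where
  "real_vec \<nu> = (\<chi> i. real (\<nu> $ i))"

definition newton_polyhedron :: "(nat ^ 'n \<Rightarrow> complex) \<Rightarrow> (real ^ 'n) set" where
  "newton_polyhedron c =
     convex hull (\<Union>\<nu>\<in>{\<nu>. c \<nu> \<noteq> 0}. (\<lambda>x. real_vec \<nu> + x) ` {x. \<forall>i. 0 \<le> x $ i})"

definition newton_boundary :: "(nat ^ 'n \<Rightarrow> complex) \<Rightarrow> (real ^ 'n) set" where
  "newton_boundary c = \<Union>{F. F face_of newton_polyhedron c \<and> compact F}"

definition weight_face :: "(nat ^ 'n \<Rightarrow> complex) \<Rightarrow> real ^ 'n \<Rightarrow> (real ^ 'n) set" where
  "weight_face c P =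
     {x \<in> newton_polyhedron c. \<forall>y\<in>newton_polyhedron c. (\<Sum>i\<in>UNIV. P $ i * x $ i) \<le> (\<Sum>i\<in>UNIV. P $ i * y $ i)}"

text \<open>
  For strictly positive \<open>P\<close> only finitely many lattice points lie on the face, so the sum is finite.
\<close>

definition face_function :: "(nat ^ 'n \<Rightarrow> complex) \<Rightarrow> real ^ 'n \<Rightarrow> complex ^ 'n \<Rightarrow> complex" where
  "face_function c P z = (\<Sum>\<nu> | real_vec \<nu> \<in> weight_face c P. c \<nu> * zmonom \<nu> z)"

definition nondegenerate :: "(nat ^ 'n \<Rightarrow> complex) \<Rightarrow> bool" where
  "nondegenerate c \<longleftrightarrow>
     (\<forall>P. (\<forall>i. 0 < P $ i) \<longrightarrow>
        \<not> (\<exists>z. (\<forall>i. z $ i \<noteq> 0) \<and> gradient (face_function c P) z = 0))"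

text \<open>
  ``Not identically zero'' is understood for germs at the origin.
\<close>

definition convenient :: "(complex ^ 'n \<Rightarrow> complex) \<Rightarrow> bool" where
  "convenient f \<longleftrightarrow>
     (\<forall>I. I \<noteq> {} \<longrightarrow>
        \<not> (\<forall>\<^sub>F z in nhds 0. (\<forall>j. j \<notin> I \<longrightarrow> z $ j = 0) \<longrightarrow> f z = 0))"

text \<open>
  In the following, \<open>b j\<close> is the exponent of the pure power of the \<open>j\<close>-th variable on the Newton boundary.
\<close>

definition lojasiewicz_monomial :: "('n::finite \<Rightarrow> nat) \<Rightarrow> 'n \<Rightarrow> bool" where
  "lojasiewicz_monomial b j \<longleftrightarrow> b j = Max (range b)"

definition exceptional_monomial ::
    "(nat ^ 'n \<Rightarrow> complex) \<Rightarrow> ('n::finite \<Rightarrow> nat) \<Rightarrow> 'n \<Rightarrow> bool" where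
  "exceptional_monomial c b j \<longleftrightarrow> lojasiewicz_monomial b j \<and>
     (\<exists>k B'. k \<noteq> j \<and> c (axis j B' + axis k 1) \<noteq> 0 \<and> B' + 1 < Max (range b))"

end

theory Submission
  imports Defs "HOL-Complex_Analysis.Cauchy_Integral_Formula"
begin

text \<open>
  Everything is measured against the Newton monomials of low degree,
  \<open>M(z) = \<Sum>\<bar>z\<^sup>\<nu>\<bar>\<close>, summed over the exponents \<open>\<nu>\<close> of degree at most \<open>B\<close> in the support of \<open>f\<close>.
  This finite set contains every support point on a face of strictly positive weight
  (\<open>inner_beyond_low_degree\<close>), and since it contains the pure powers, \<open>\<bar>z\<^sub>i\<bar>\<^sup>B \<le> M(z)\<close>
  near the origin for every \<open>i\<close>; so the part of the series of degree greater than \<open>B\<close> is negligible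
  compared with \<open>M(z)\<close>.

  The core of the upper bound is the estimate \<open>\<kappa> M(z) \<le> \<Sum>\<bar>z\<^sub>i \<partial>\<^sub>i f(z)\<bar>\<close> near the origin
  (\<open>euler_sum_lower_bound\<close>), which is where non-degeneracy enters. If it failed along a sequence in the
  torus tending to the origin, then after passing to a subsequence the monomials divided by \<open>M\<close> would
  converge, and \<open>toric_limit\<close> identifies the limit: the monomials on the face of some strictly
  positive weight \<open>P\<close> tend to a common multiple of their values at one point \<open>w\<close> of the torus, the
  others to zero. Hence \<open>z\<^sub>i \<partial>\<^sub>i f / M\<close> would tend to a multiple of \<open>w\<^sub>i \<partial>\<^sub>i f\<^sub>P(w)\<close>, and \<open>w\<close> would be a
  critical point of \<open>f\<^sub>P\<close>. Points with vanishing coordinates follow by continuity.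

  As \<open>\<bar>z\<^sub>i\<bar> \<le> M\<^bsup>1/B\<^esup>\<close> and \<open>\<bar>f\<bar> \<le> L M\<close> (\<open>value_le_size\<close>), the estimate gives
  \<open>\<parallel>\<partial>f\<parallel> \<ge> C M\<^bsup>1-1/B\<^esup> \<ge> C' \<bar>f\<bar>\<^bsup>1-1/B\<^esup>\<close>, so the exponent \<open>1 - 1/B\<close> itself is admissible.

  For the equality, let \<open>z\<^sub>j\<^sup>B\<close> be a non-exceptional monomial and move along the \<open>j\<close>-th axis.
  There \<open>f\<close> has exact order \<open>B\<close>. The only monomials of \<open>f\<close> that contribute to \<open>\<partial>f\<close> on the axis
  are the powers of \<open>z\<^sub>j\<close> and the monomials \<open>z\<^sub>j\<^sup>m z\<^sub>k\<close>, and none of the latter has \<open>m < B - 1\<close>. So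
  \<open>\<partial>f\<close> has order at least \<open>B - 1\<close> there (\<open>gradient_on_axis_le\<close>), and every admissible
  exponent \<open>\<theta>\<close> satisfies \<open>B \<theta> \<ge> B - 1\<close> (\<open>lojasiewicz_ineq_imp_ge\<close>).
\<close>

section \<open>Monomials in several variables\<close>

definition mdeg :: "nat ^ 'n \<Rightarrow> nat" where
  "mdeg \<nu> = (\<Sum>i\<in>UNIV. \<nu> $ i)"

text \<open>
  The formal derivative of a monomial in the \<open>i\<close>-th variable. If the exponent of that variable is zero,
  the factor \<open>of_nat 0\<close> hides the truncated subtraction.
\<close>

definition deriv_monom :: "'n \<Rightarrow> nat ^ 'n \<Rightarrow> complex ^ 'n \<Rightarrow> complex" where
  "deriv_monom i \<nu> z = of_nat (\<nu> $ i) * z $ i ^ (\<nu> $ i - 1) * (\<Prod>j\<in>UNIV - {i}. z $ j ^ (\<nu> $ j))"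

lemma exponent_le_mdeg: "\<nu> $ i \<le> mdeg \<nu>"
  unfolding mdeg_def by (rule member_le_sum) auto

lemma mdeg_axis [simp]: "mdeg (axis i k) = k"
  by (simp add: mdeg_def axis_def if_distrib sum.delta cong: if_cong)

lemma mdeg_add: "mdeg (\<mu> + \<nu>) = mdeg \<mu> + mdeg \<nu>"
  by (simp add: mdeg_def sum.distrib)

lemma zmonom_split: "zmonom \<nu> z = z $ i ^ (\<nu> $ i) * (\<Prod>j\<in>UNIV - {i}. z $ j ^ (\<nu> $ j))"
  unfolding zmonom_def by (simp add: prod.remove[of UNIV i])

lemma zmonom_axis [simp]: "zmonom (axis i k) z = z $ i ^ k"
proof -
  have "(\<Prod>j\<in>UNIV - {i}. z $ j ^ (axis i k $ j)) = 1"
    by (rule prod.neutral) (auto simp: axis_def)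
  then show ?thesis by (simp add: zmonom_split[of _ _ i])
qed

lemma finite_mdeg_le: "finite {\<nu> :: nat ^ 'n. mdeg \<nu> \<le> d}"
proof -
  have "{\<nu> :: nat ^ 'n. mdeg \<nu> \<le> d} \<subseteq> vec_lambda ` (\<Pi>\<^sub>E i\<in>UNIV. {..d})"
  proof
    fix \<nu> :: "nat ^ 'n" assume "\<nu> \<in> {\<nu>. mdeg \<nu> \<le> d}"
    then have "\<And>i. \<nu> $ i \<le> d" using exponent_le_mdeg le_trans by blast
    then have "vec_nth \<nu> \<in> (\<Pi>\<^sub>E i\<in>UNIV. {..d})" by auto
    then show "\<nu> \<in> vec_lambda ` (\<Pi>\<^sub>E i\<in>UNIV. {..d})"
      by (metis image_eqI vec_nth_inverse)
  qed
  then show ?thesis by (rule finite_subset) (simp add: finite_PiE)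
qed

lemma norm_zmonom_le:
  assumes "\<And>i. norm (z $ i) \<le> s"
  shows "norm (zmonom \<nu> z) \<le> s ^ mdeg \<nu>"
proof -
  have "norm (zmonom \<nu> z) \<le> (\<Prod>i\<in>UNIV. s ^ (\<nu> $ i))"
    unfolding zmonom_def prod_norm[symmetric] norm_power
    by (rule prod_mono) (use assms in \<open>auto intro: power_mono\<close>)
  then show ?thesis by (simp add: mdeg_def power_sum)
qed

lemma norm_deriv_monom_le:
  assumes "\<And>i. norm (z $ i) \<le> s"
  shows "norm (deriv_monom i \<nu> z) \<le> real (mdeg \<nu>) * s ^ (mdeg \<nu> - 1)"
proof (cases "\<nu> $ i = 0")
  case True
  have "s \<ge> 0" using assms[of i] norm_ge_zero order_trans by blast
  with True show ?thesis by (simp add: deriv_monom_def)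
next
  case False
  have s: "s \<ge> 0" using assms[of i] norm_ge_zero order_trans by blast
  have md: "mdeg \<nu> = \<nu> $ i + (\<Sum>j\<in>UNIV - {i}. \<nu> $ j)"
    unfolding mdeg_def by (simp add: sum.remove[of UNIV i])
  have "norm (\<Prod>j\<in>UNIV - {i}. z $ j ^ (\<nu> $ j)) \<le> (\<Prod>j\<in>UNIV - {i}. s ^ (\<nu> $ j))"
    unfolding prod_norm[symmetric] norm_power
    by (rule prod_mono) (use assms in \<open>auto intro: power_mono\<close>)
  then have "norm (z $ i) ^ (\<nu> $ i - 1) * norm (\<Prod>j\<in>UNIV - {i}. z $ j ^ (\<nu> $ j))
      \<le> s ^ (\<nu> $ i - 1) * s ^ (\<Sum>j\<in>UNIV - {i}. \<nu> $ j)"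
    using assms s by (intro mult_mono) (auto simp: power_sum intro!: power_mono)
  also have "\<dots> = s ^ (mdeg \<nu> - 1)"
    using False md by (simp add: power_add[symmetric])
  finally have "real (\<nu> $ i) * (norm (z $ i) ^ (\<nu> $ i - 1) * norm (\<Prod>j\<in>UNIV - {i}. z $ j ^ (\<nu> $ j)))
      \<le> real (mdeg \<nu>) * s ^ (mdeg \<nu> - 1)"
    using exponent_le_mdeg[of \<nu> i] s by (intro mult_mono) auto
  then show ?thesis by (simp add: deriv_monom_def norm_mult norm_power mult.assoc)
qed

lemma euler_deriv_monom: "z $ i * deriv_monom i \<nu> z = of_nat (\<nu> $ i) * zmonom \<nu> z"
proof (cases "\<nu> $ i")
  case 0 then show ?thesis by (simp add: deriv_monom_def)
next
  case (Suc k) then show ?thesis by (simp add: deriv_monom_def zmonom_split[of _ _ i])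
qed

lemma has_field_derivative_zmonom:
  "((\<lambda>w. zmonom \<nu> (z + axis i w)) has_field_derivative deriv_monom i \<nu> (z + axis i w)) (at w)"
proof -
  have off: "(\<Prod>j\<in>UNIV - {i}. (z + axis i u) $ j ^ (\<nu> $ j)) = (\<Prod>j\<in>UNIV - {i}. z $ j ^ (\<nu> $ j))" for u
    by (rule prod.cong) (auto simp: axis_def)
  have "((\<lambda>w. (z $ i + w) ^ (\<nu> $ i) * (\<Prod>j\<in>UNIV - {i}. z $ j ^ (\<nu> $ j))) has_field_derivative
      of_nat (\<nu> $ i) * (z $ i + w) ^ (\<nu> $ i - 1) * (\<Prod>j\<in>UNIV - {i}. z $ j ^ (\<nu> $ j))) (at w)"
    by (auto intro!: derivative_eq_intros)
  then show ?thesis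
    unfolding zmonom_split[of _ _ i] deriv_monom_def off by simp
qed

lemma continuous_on_zmonom: "continuous_on A (zmonom \<nu>)"
  unfolding zmonom_def [abs_def] by (intro continuous_intros)

lemma partial_deriv_polynomial:
  assumes "finite S"
  shows "partial_deriv i (\<lambda>z. \<Sum>\<nu>\<in>S. a \<nu> * zmonom \<nu> z) z = (\<Sum>\<nu>\<in>S. a \<nu> * deriv_monom i \<nu> z)"
proof -
  have "((\<lambda>w. \<Sum>\<nu>\<in>S. a \<nu> * zmonom \<nu> (z + axis i w)) has_field_derivative
      (\<Sum>\<nu>\<in>S. a \<nu> * deriv_monom i \<nu> (z + axis i 0))) (at 0)"
    by (intro DERIV_sum DERIV_cmult has_field_derivative_zmonom)
  then show ?thesis
    unfolding partial_deriv_def by (auto intro!: DERIV_imp_deriv simp: axis_def vec_eq_iff zero_vec_def[symmetric])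
qed

section \<open>Power series dominated on a polydisc\<close>

text \<open>
  The weight \<open>deg \<nu> + 1\<close> lets one summability hypothesis dominate both the series of \<open>f\<close> and its
  termwise Euler derivatives \<open>z\<^sub>i \<partial>\<^sub>i f\<close>.
\<close>

locale dominated_series =
  fixes f :: "complex ^ 'n \<Rightarrow> complex" and c :: "nat ^ 'n \<Rightarrow> complex" and \<rho> :: real
  assumes radius_pos: "\<rho> > 0"
    and dominated: "(\<lambda>\<nu>. (real (mdeg \<nu>) + 1) * norm (c \<nu>) * \<rho> ^ mdeg \<nu>) summable_on UNIV"
    and expansion: "(\<And>i. norm (z $ i) \<le> \<rho>) \<Longrightarrow> ((\<lambda>\<nu>. c \<nu> * zmonom \<nu> z) has_sum f z) UNIV"

lemma norm_le_sum_components: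
  fixes z :: "complex ^ 'n" shows "norm z \<le> (\<Sum>i\<in>UNIV. norm (z $ i))"
  unfolding norm_vec_def by (rule L2_set_le_sum) auto

text \<open>
  Convergence at one point with equal positive coordinates \<open>2\<rho>\<close> is absolute; halving the radius
  pays for the weight, because \<open>d + 1 \<le> 2\<^sup>d\<close>.
\<close>

lemma has_power_series_imp_dominated:
  fixes f :: "complex ^ 'n \<Rightarrow> complex"
  assumes "has_power_series_at_0 f c"
  shows "\<exists>\<rho>. dominated_series f c \<rho>"
proof -
  obtain r where r: "r > 0" "\<And>z. norm z < r \<Longrightarrow> ((\<lambda>\<nu>. c \<nu> * zmonom \<nu> z) has_sum f z) UNIV"
    using assms by (auto simp: has_power_series_at_0_def)
  define N where "N = real CARD('n)"
  have N: "N \<ge> 1" unfolding N_def by (simp add: Suc_le_eq)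
  define \<rho> where "\<rho> = r / (4 * N)"
  have \<rho>: "\<rho> > 0" using r N by (simp add: \<rho>_def)
  have small: "norm z \<le> N * s" if "\<And>i. norm (z $ i) \<le> s" for z :: "complex ^ 'n" and s
    using norm_le_sum_components[of z] sum_bounded_above[of UNIV "\<lambda>i. norm (z $ i)" s] that
    by (simp add: N_def)
  define u :: "complex ^ 'n" where "u = (\<chi> i. of_real (2 * \<rho>))"
  have "norm u \<le> N * (2 * \<rho>)" by (rule small) (use \<rho> in \<open>simp add: u_def\<close>)
  also have "\<dots> < r" using r N by (simp add: \<rho>_def)
  finally have "(\<lambda>\<nu>. c \<nu> * zmonom \<nu> u) summable_on UNIV" using r(2) has_sum_imp_summable by blast
  then have "(\<lambda>\<nu>. norm (c \<nu> * zmonom \<nu> u)) summable_on UNIV"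
    by (rule iffD1[OF summable_on_iff_abs_summable_on_complex])
  moreover have "norm (c \<nu> * zmonom \<nu> u) = norm (c \<nu>) * (2 * \<rho>) ^ mdeg \<nu>" for \<nu>
  proof -
    have "zmonom \<nu> u = of_real (2 * \<rho>) ^ mdeg \<nu>"
      by (simp only: zmonom_def u_def vec_lambda_beta mdeg_def power_sum)
    then show ?thesis using \<rho> by (simp add: norm_mult norm_power)
  qed
  ultimately have S: "(\<lambda>\<nu>. norm (c \<nu>) * (2 * \<rho>) ^ mdeg \<nu>) summable_on UNIV" by simp
  show ?thesis
  proof (intro exI dominated_series.intro)
    show "\<rho> > 0" by fact
    show "(\<lambda>\<nu>. (real (mdeg \<nu>) + 1) * norm (c \<nu>) * \<rho> ^ mdeg \<nu>) summable_on UNIV"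
    proof (rule summable_on_comparison_test[OF S])
      fix \<nu> :: "nat ^ 'n"
      have "mdeg \<nu> + 1 \<le> 2 ^ mdeg \<nu>" using less_exp[of "mdeg \<nu>"] by linarith
      then have "real (mdeg \<nu> + 1) \<le> real (2 ^ mdeg \<nu>)" by (simp only: of_nat_le_iff)
      then have "real (mdeg \<nu>) + 1 \<le> 2 ^ mdeg \<nu>" by simp
      then have "(real (mdeg \<nu>) + 1) * (norm (c \<nu>) * \<rho> ^ mdeg \<nu>) \<le> 2 ^ mdeg \<nu> * (norm (c \<nu>) * \<rho> ^ mdeg \<nu>)"
        using \<rho> by (intro mult_right_mono) auto
      then show "(real (mdeg \<nu>) + 1) * norm (c \<nu>) * \<rho> ^ mdeg \<nu> \<le> norm (c \<nu>) * (2 * \<rho>) ^ mdeg \<nu>"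
        by (simp add: power_mult_distrib mult_ac)
    qed (use \<rho> in auto)
    fix z :: "complex ^ 'n" assume "\<And>i. norm (z $ i) \<le> \<rho>"
    then have "norm z \<le> N * \<rho>" by (rule small)
    also have "\<dots> < r" using r N by (simp add: \<rho>_def)
    finally show "((\<lambda>\<nu>. c \<nu> * zmonom \<nu> z) has_sum f z) UNIV" by (rule r)
  qed
qed

context dominated_series
begin

text \<open>
  In one variable, locally uniform limits of holomorphic functions may be differentiated termwise. This
  is applied to the net of partial sums over finite sets of exponents.
\<close>

lemma has_sum_partial_deriv:
  assumes "\<And>i. norm (z $ i) < \<rho>"
  shows "((\<lambda>\<nu>. c \<nu> * deriv_monom i \<nu> z) has_sum partial_deriv i f z) UNIV"
proof -
  define e where "e = \<rho> - norm (z $ i)"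
  have e: "e > 0" using assms[of i] by (simp add: e_def)
  have in_disc: "norm ((z + axis i w) $ j) \<le> \<rho>" if "w \<in> cball 0 e" for w j
  proof (cases "j = i")
    case True
    have "norm (z $ i + w) \<le> norm (z $ i) + norm w" by (rule norm_triangle_ineq)
    then show ?thesis using that True by (simp add: e_def)
  next
    case False
    then show ?thesis using assms[of j] by (simp add: axis_def)
  qed
  have coeffs: "(\<lambda>\<nu>. norm (c \<nu>) * \<rho> ^ mdeg \<nu>) summable_on UNIV"
    by (rule summable_on_comparison_test[OF dominated])
       (use radius_pos in \<open>auto simp: distrib_right\<close>)
  have unif: "uniform_limit (cball 0 e) (\<lambda>F w. \<Sum>\<nu>\<in>F. c \<nu> * zmonom \<nu> (z + axis i w))
      (\<lambda>w. f (z + axis i w)) (finite_subsets_at_top UNIV)"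
  proof (rule Weierstrass_m_test_general'[OF _ _ coeffs])
    fix \<nu> :: "nat ^ 'n" and w :: complex assume "w \<in> cball 0 e"
    then show "norm (c \<nu> * zmonom \<nu> (z + axis i w)) \<le> norm (c \<nu>) * \<rho> ^ mdeg \<nu>"
      unfolding norm_mult by (intro mult_left_mono norm_zmonom_le in_disc) auto
  qed (intro expansion in_disc)
  have der: "((\<lambda>w. \<Sum>\<nu>\<in>F. c \<nu> * zmonom \<nu> (z + axis i w)) has_field_derivative
      (\<Sum>\<nu>\<in>F. c \<nu> * deriv_monom i \<nu> (z + axis i w))) (at w)" for F w
    by (intro DERIV_sum DERIV_cmult has_field_derivative_zmonom)
  have cont: "\<forall>\<^sub>F F in finite_subsets_at_top UNIV.
      continuous_on (cball 0 e) (\<lambda>w. \<Sum>\<nu>\<in>F. c \<nu> * zmonom \<nu> (z + axis i w)) \<and>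
      (\<forall>w\<in>ball 0 e. ((\<lambda>w. \<Sum>\<nu>\<in>F. c \<nu> * zmonom \<nu> (z + axis i w)) has_field_derivative
      (\<Sum>\<nu>\<in>F. c \<nu> * deriv_monom i \<nu> (z + axis i w))) (at w))"
    using der by (intro always_eventually allI conjI ballI DERIV_continuous_on)
      (auto intro: has_field_derivative_at_within)
  then obtain g' where "\<And>w. w \<in> ball 0 e \<Longrightarrow>
      ((\<lambda>w. f (z + axis i w)) has_field_derivative g' w) (at w) \<and>
      ((\<lambda>F. \<Sum>\<nu>\<in>F. c \<nu> * deriv_monom i \<nu> (z + axis i w)) \<longlongrightarrow> g' w) (finite_subsets_at_top UNIV)"
    using has_complex_derivative_uniform_limit[OF cont unif finite_subsets_at_top_neq_bot e] by blast
  then have "((\<lambda>w. f (z + axis i w)) has_field_derivative g' 0) (at 0)"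
    and lim: "((\<lambda>F. \<Sum>\<nu>\<in>F. c \<nu> * deriv_monom i \<nu> (z + axis i 0)) \<longlongrightarrow> g' 0) (finite_subsets_at_top UNIV)"
    using e by (simp_all add: centre_in_ball)
  then have "partial_deriv i f z = g' 0"
    unfolding partial_deriv_def by (intro DERIV_imp_deriv)
  moreover have shift: "z + axis i 0 = z" by (simp add: vec_eq_iff axis_def)
  ultimately show ?thesis
    using lim unfolding has_sum_def shift by simp
qed

lemma has_sum_euler_deriv:
  assumes "\<And>i. norm (z $ i) < \<rho>"
  shows "((\<lambda>\<nu>. of_nat (\<nu> $ i) * c \<nu> * zmonom \<nu> z) has_sum z $ i * partial_deriv i f z) UNIV"
  using has_sum_cmult_right[OF has_sum_partial_deriv[OF assms, of i], of "z $ i"]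
  by (simp add: euler_deriv_monom mult.left_commute[of "z $ i"] mult_ac)

text \<open>
  A series whose terms below degree \<open>N + q\<close> vanish has order at least \<open>N\<close> after \<open>q\<close> differentiations,
  with a constant independent of the particular series. The cases of use are \<open>q = 0\<close>, for \<open>f\<close> and its
  Euler derivatives, and \<open>q = 1\<close>, for a partial derivative.
\<close>

lemma high_order_bound:
  fixes q N :: nat
  shows "\<exists>K\<ge>0. \<forall>h S s. 0 \<le> s \<longrightarrow> s \<le> \<rho> \<longrightarrow> (h has_sum S) UNIV \<longrightarrow>
    (\<forall>\<nu>. norm (h \<nu>) \<le> (real (mdeg \<nu>) + 1) * norm (c \<nu>) * s ^ (mdeg \<nu> - q)) \<longrightarrow>
    (\<forall>\<nu>. mdeg \<nu> < N + q \<longrightarrow> h \<nu> = 0) \<longrightarrow> norm (S :: complex) \<le> K * s ^ N"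
proof -
  define a where "a \<nu> = (real (mdeg \<nu>) + 1) * norm (c \<nu>)" for \<nu>
  define T where "T = (\<Sum>\<^sub>\<infinity>\<nu>. a \<nu> * \<rho> ^ mdeg \<nu>)"
  have a: "a \<nu> \<ge> 0" for \<nu> by (simp add: a_def)
  have T: "((\<lambda>\<nu>. a \<nu> * \<rho> ^ mdeg \<nu>) has_sum T) UNIV"
    using dominated unfolding T_def a_def by (rule has_sum_infsum)
  have "T \<ge> 0" unfolding T_def using a radius_pos by (intro infsum_nonneg) auto
  show ?thesis
  proof (intro exI[of _ "T / \<rho> ^ (N + q)"] conjI allI impI)
    show "0 \<le> T / \<rho> ^ (N + q)" using \<open>T \<ge> 0\<close> radius_pos by simp
    fix h :: "nat ^ 'n \<Rightarrow> complex" and S s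
    assume s: "0 \<le> s" "s \<le> \<rho>" and h: "(h has_sum S) UNIV"
      and le: "\<forall>\<nu>. norm (h \<nu>) \<le> (real (mdeg \<nu>) + 1) * norm (c \<nu>) * s ^ (mdeg \<nu> - q)"
      and low: "\<forall>\<nu>. mdeg \<nu> < N + q \<longrightarrow> h \<nu> = 0"
    have "norm S \<le> (s ^ N / \<rho> ^ (N + q)) * T"
    proof (rule norm_infsum_le[OF h has_sum_cmult_right[OF T]])
      fix \<nu> :: "nat ^ 'n"
      show "norm (h \<nu>) \<le> s ^ N / \<rho> ^ (N + q) * (a \<nu> * \<rho> ^ mdeg \<nu>)"
      proof (cases "mdeg \<nu> < N + q")
        case True
        then show ?thesis using low a s radius_pos by simp
      next
        case False
        then obtain d where d: "mdeg \<nu> = N + q + d" by (auto simp: not_less le_iff_add)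
        have "norm (h \<nu>) \<le> a \<nu> * s ^ (N + d)" using le[rule_format, of \<nu>] by (simp add: a_def d)
        also have "\<dots> \<le> a \<nu> * (s ^ N * \<rho> ^ d)"
          unfolding power_add using s a by (intro mult_left_mono power_mono) auto
        also have "\<dots> = s ^ N / \<rho> ^ (N + q) * (a \<nu> * \<rho> ^ mdeg \<nu>)"
          unfolding d power_add using radius_pos by simp
        finally show ?thesis .
      qed
    qed
    then show "norm S \<le> T / \<rho> ^ (N + q) * s ^ N" by (simp add: mult_ac)
  qed
qed

lemma value_at_0: "f 0 = c 0"
proof -
  have z: "c \<nu> * zmonom \<nu> 0 = (if \<nu> = 0 then c 0 else 0)" for \<nu>
    by (auto simp: zmonom_def vec_eq_iff power_0_left intro!: arg_cong[of _ _ c])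
  have "((\<lambda>\<nu>. c \<nu> * zmonom \<nu> 0) has_sum f 0) UNIV" using radius_pos by (intro expansion) auto
  moreover have "((\<lambda>\<nu>. c \<nu> * zmonom \<nu> 0) has_sum c 0) UNIV"
    unfolding z by (rule has_sum_finite_neutralI[of "{0}"]) auto
  ultimately show ?thesis by (rule has_sum_unique)
qed

lemma pure_power_exponent_pos:
  assumes "f 0 = 0" "c (axis i m) \<noteq> 0"
  shows "m \<ge> 1"
proof (rule ccontr)
  assume "\<not> m \<ge> 1"
  then have "axis i m = 0" by (simp add: axis_eq_0_iff)
  then show False using assms value_at_0 by metis
qed

text \<open>
  This continuity carries the estimate of the Euler derivatives from the torus to points on the
  coordinate hyperplanes.
\<close>

lemma continuous_on_euler_deriv:
  "continuous_on {z. \<forall>i. norm (z $ i) < \<rho>} (\<lambda>z. z $ i * partial_deriv i f z)"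
proof (rule uniform_limit_theorem)
  show "\<forall>\<^sub>F F in finite_subsets_at_top UNIV. continuous_on {z. \<forall>i. norm (z $ i) < \<rho>}
      (\<lambda>z. \<Sum>\<nu>\<in>F. of_nat (\<nu> $ i) * c \<nu> * zmonom \<nu> z)"
    by (intro always_eventually allI continuous_on_sum continuous_on_mult continuous_on_const continuous_on_zmonom)
  show "uniform_limit {z. \<forall>i. norm (z $ i) < \<rho>} (\<lambda>F z. \<Sum>\<nu>\<in>F. of_nat (\<nu> $ i) * c \<nu> * zmonom \<nu> z)
      (\<lambda>z. z $ i * partial_deriv i f z) (finite_subsets_at_top UNIV)"
  proof (rule Weierstrass_m_test_general'[OF _ _ dominated])
    fix \<nu> z assume z: "z \<in> {z :: complex ^ 'n. \<forall>i. norm (z $ i) < \<rho>}"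
    have "real (\<nu> $ i) \<le> real (mdeg \<nu>) + 1" using exponent_le_mdeg[of \<nu> i] by simp
    then show "norm (of_nat (\<nu> $ i) * c \<nu> * zmonom \<nu> z) \<le> (real (mdeg \<nu>) + 1) * norm (c \<nu>) * \<rho> ^ mdeg \<nu>"
      using z unfolding norm_mult by (intro mult_mono norm_zmonom_le) (auto simp: less_imp_le)
  qed (auto intro: has_sum_euler_deriv)
qed simp

end

section \<open>Degeneration of points of the torus\<close>

definition monom_size :: "(nat ^ 'n) set \<Rightarrow> complex ^ 'n \<Rightarrow> real" where
  "monom_size V z = (\<Sum>\<nu>\<in>V. norm (zmonom \<nu> z))"

lemma zmonom_nonzero: "(\<And>i. z $ i \<noteq> 0) \<Longrightarrow> zmonom \<nu> z \<noteq> 0"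
  by (simp add: zmonom_def)

lemma monom_size_nonneg: "monom_size V z \<ge> 0"
  unfolding monom_size_def by (intro sum_nonneg) simp

lemma monom_size_pos:
  assumes "finite V" "V \<noteq> {}" "\<And>i. z $ i \<noteq> 0"
  shows "monom_size V z > 0"
  unfolding monom_size_def using assms by (intro sum_pos) (auto simp: zmonom_nonzero)

lemma norm_zmonom_le_size: "finite V \<Longrightarrow> \<nu> \<in> V \<Longrightarrow> norm (zmonom \<nu> z) \<le> monom_size V z"
  unfolding monom_size_def by (rule member_le_sum) auto

lemma inner_real_vec: "x \<bullet> real_vec \<nu> = (\<Sum>i\<in>UNIV. x $ i * real (\<nu> $ i))"
  by (simp add: inner_vec_def real_vec_def)

lemma ln_norm_zmonom:
  assumes "\<And>i. z $ i \<noteq> 0"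
  shows "ln (norm (zmonom \<nu> z)) = (\<chi> i. ln (norm (z $ i))) \<bullet> real_vec \<nu>"
proof -
  have "ln (norm (zmonom \<nu> z)) = (\<Sum>i\<in>UNIV. ln (norm (z $ i) ^ (\<nu> $ i)))"
    unfolding zmonom_def prod_norm[symmetric] norm_power using assms by (intro ln_prod) auto
  then show ?thesis
    unfolding inner_real_vec using assms by (simp add: ln_realpow mult.commute)
qed

text \<open>
  A real vector \<open>q\<close> acts on the torus by \<open>z\<^sub>i \<mapsto> exp(q\<^sub>i) z\<^sub>i\<close>; monomials are the characters of
  this action.
\<close>

lemma zmonom_rescale:
  "zmonom \<nu> (\<chi> i. z $ i * of_real (exp (q $ i))) = zmonom \<nu> z * of_real (exp (q \<bullet> real_vec \<nu>))"
proof -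
  have "exp (q $ i * real (\<nu> $ i)) = exp (q $ i) ^ (\<nu> $ i)" for i
    by (metis exp_of_nat_mult mult.commute)
  then have "exp (q \<bullet> real_vec \<nu>) = (\<Prod>i\<in>UNIV. exp (q $ i) ^ (\<nu> $ i))"
    by (simp add: inner_real_vec exp_sum)
  then show ?thesis by (simp add: zmonom_def power_mult_distrib prod.distrib)
qed

lemma common_convergent_subsequence:
  fixes g :: "'v \<Rightarrow> nat \<Rightarrow> 'a :: heine_borel"
  assumes "finite V" "\<And>v. v \<in> V \<Longrightarrow> bounded (range (g v))"
  shows "\<exists>r. strict_mono (r :: nat \<Rightarrow> nat) \<and> (\<forall>v\<in>V. convergent (\<lambda>m. g v (r m)))"
  using assms
proof (induction V rule: finite_induct)
  case empty
  show ?case by (intro exI[of _ "\<lambda>m. m"]) (simp add: strict_mono_def)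
next
  case (insert v V)
  then obtain r where r: "strict_mono r" "\<And>u. u \<in> V \<Longrightarrow> convergent (\<lambda>m. g u (r m))" by auto
  have "bounded (range (\<lambda>m. g v (r m)))"
    by (rule bounded_subset[of "range (g v)"]) (use insert.prems in auto)
  then obtain l s where s: "strict_mono s" "((\<lambda>m. g v (r m)) \<circ> s) \<longlonglongrightarrow> l"
    using bounded_imp_convergent_subsequence by blast
  have "convergent (\<lambda>m. g u (r (s m)))" if "u \<in> insert v V" for u
  proof (cases "u = v")
    case True
    with s show ?thesis by (auto simp: convergent_def o_def)
  next
    case False
    with that show ?thesis using convergent_subseq_convergent[OF r(2) s(1)] by (auto simp: o_def)
  qed
  moreover have "strict_mono (\<lambda>m. r (s m))" using r(1) s(1) by (simp add: strict_mono_def)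
  ultimately show ?case by (intro exI[of _ "\<lambda>m. r (s m)"]) auto
qed

text \<open>
  The vectors against which the sequence has convergent inner products form a subspace, hence contain the
  span of \<open>D\<close>. The orthogonal projection of the sequence to that span therefore converges, and
  it serves as \<open>p\<close>.
\<close>

lemma convergent_orthogonal_correction:
  fixes x :: "nat \<Rightarrow> 'a :: euclidean_space"
  assumes conv: "\<And>d. d \<in> D \<Longrightarrow> convergent (\<lambda>m. x m \<bullet> d)"
  shows "\<exists>p. convergent p \<and> (\<forall>m. \<forall>d\<in>D. (x m - p m) \<bullet> d = 0)"
proof -
  obtain E where E: "pairwise orthogonal E" "\<And>e. e \<in> E \<Longrightarrow> norm e = 1"
    "independent E" "span E = span D"
    by (metis orthonormal_basis_subspace subspace_span span_span)
  have finE: "finite E" using E(3) by (rule independent_imp_finite)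
  have "subspace {u. convergent (\<lambda>m. x m \<bullet> u)}"
    by (auto simp: subspace_def inner_add_right intro!: convergent_add convergent_mult convergent_const)
  then have "span D \<subseteq> {u. convergent (\<lambda>m. x m \<bullet> u)}"
    by (intro span_minimal) (use conv in auto)
  then have convE: "convergent (\<lambda>m. x m \<bullet> e)" if "e \<in> E" for e
    using E(4) span_base[OF that] by blast
  define p where "p m = (\<Sum>e\<in>E. (x m \<bullet> e) *\<^sub>R e)" for m
  have ortho: "(x m - p m) \<bullet> e = 0" if "e \<in> E" for m e
  proof -
    have "(x m \<bullet> e') * (e' \<bullet> e) = (if e' = e then x m \<bullet> e else 0)" if "e' \<in> E" for e'
      using E(1,2) \<open>e \<in> E\<close> that by (auto simp: pairwise_def orthogonal_def dot_square_norm)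
    then have "p m \<bullet> e = (\<Sum>e'\<in>E. if e' = e then x m \<bullet> e else 0)"
      unfolding p_def inner_sum_left by (intro sum.cong) auto
    then show ?thesis using finE that by (simp add: inner_diff_left)
  qed
  show ?thesis
  proof (intro exI[of _ p] conjI allI ballI)
    have "\<forall>e\<in>E. \<exists>l. (\<lambda>m. x m \<bullet> e) \<longlonglongrightarrow> l" using convE by (auto simp: convergent_def)
    then obtain l where "\<And>e. e \<in> E \<Longrightarrow> (\<lambda>m. x m \<bullet> e) \<longlonglongrightarrow> l e" by metis
    then have "p \<longlonglongrightarrow> (\<Sum>e\<in>E. l e *\<^sub>R e)"
      unfolding p_def [abs_def] by (intro tendsto_sum tendsto_scaleR tendsto_const)
    then show "convergent p" by (auto simp: convergent_def)
    fix m d assume "d \<in> D"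
    then have "d \<in> span E" using E(4) span_base by blast
    moreover have "orthogonal (x m - p m) e" if "e \<in> E" for e using ortho that by (simp add: orthogonal_def)
    ultimately show "(x m - p m) \<bullet> d = 0"
      using orthogonal_to_span[of d E] by (auto simp: orthogonal_def)
  qed
qed

text \<open>
  Let \<open>S\<close> consist of the exponents whose normalised monomials do not tend to zero. The vectors
  \<open>x = - ln \<bar>z\<bar>\<close> (taken componentwise) have convergent inner products with the differences of elements of
  \<open>S\<close>, since these are logarithms of ratios of monomials with non-zero limits. So \<open>x = p + Q\<close> with \<open>p\<close>
  convergent and \<open>Q\<close> constant on \<open>S\<close>. A weight \<open>P\<close> is obtained as \<open>Q\<close> far out in the sequence,
  and \<open>w\<close> is a limit of the points \<open>exp(Q) z\<close>, whose absolute values \<open>exp(-p)\<close> stay away from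
  zero and infinity.
\<close>

lemma toric_limit:
  fixes z :: "nat \<Rightarrow> complex ^ 'n" and V :: "(nat ^ 'n) set"
  assumes V: "finite V" "V \<noteq> {}"
    and torus: "\<And>m i. z m $ i \<noteq> 0"
    and lim0: "\<And>i. (\<lambda>m. z m $ i) \<longlonglongrightarrow> 0"
  obtains r S P w l d where "strict_mono (r :: nat \<Rightarrow> nat)" "S \<subseteq> V" "S \<noteq> {}" "\<And>i. P $ i > 0"
    "\<And>i. w $ i \<noteq> 0" "l \<noteq> 0"
    "\<And>\<nu>. \<nu> \<in> S \<Longrightarrow> P \<bullet> real_vec \<nu> = d" "\<And>\<nu>. \<nu> \<in> V - S \<Longrightarrow> P \<bullet> real_vec \<nu> > d"
    "\<And>\<nu>. \<nu> \<in> V \<Longrightarrow> (\<lambda>m. zmonom \<nu> (z (r m)) / of_real (monom_size V (z (r m))))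
        \<longlonglongrightarrow> (if \<nu> \<in> S then l * zmonom \<nu> w else 0)"
proof -
  define g where "g \<nu> m = zmonom \<nu> (z m) / of_real (monom_size V (z m))" for \<nu> m
  have size: "monom_size V (z m) > 0" for m using V torus by (intro monom_size_pos)
  have "norm (g \<nu> m) \<le> 1" if "\<nu> \<in> V" for \<nu> m
    using norm_zmonom_le_size[OF V(1) that, of "z m"] size[of m] by (simp add: g_def norm_divide)
  then have "bounded (range (g \<nu>))" if "\<nu> \<in> V" for \<nu> using that by (auto intro!: boundedI)
  then obtain r1 where r1: "strict_mono r1" "\<And>\<nu>. \<nu> \<in> V \<Longrightarrow> convergent (\<lambda>m. g \<nu> (r1 m))"
    using common_convergent_subsequence[OF V(1)] by blast
  then have "\<forall>\<nu>\<in>V. \<exists>l. (\<lambda>m. g \<nu> (r1 m)) \<longlonglongrightarrow> l" by (auto simp: convergent_def)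
  then obtain a where a: "\<And>\<nu>. \<nu> \<in> V \<Longrightarrow> (\<lambda>m. g \<nu> (r1 m)) \<longlonglongrightarrow> a \<nu>" by metis
  define S where "S = {\<nu>\<in>V. a \<nu> \<noteq> 0}"
  have S_ne: "S \<noteq> {}"
  proof
    assume "S = {}"
    then have "(\<lambda>m. \<Sum>\<nu>\<in>V. norm (g \<nu> (r1 m))) \<longlonglongrightarrow> (\<Sum>\<nu>\<in>V. norm (a \<nu>))"
      by (intro tendsto_sum tendsto_norm a)
    moreover have "(\<Sum>\<nu>\<in>V. norm (a \<nu>)) = 0" using \<open>S = {}\<close> by (auto simp: S_def)
    moreover have "(\<Sum>\<nu>\<in>V. norm (g \<nu> (r1 m))) = 1" for m
    proof -
      have "(\<Sum>\<nu>\<in>V. norm (g \<nu> (r1 m))) =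
          (\<Sum>\<nu>\<in>V. norm (zmonom \<nu> (z (r1 m)))) / monom_size V (z (r1 m))"
        using size[of "r1 m"] by (simp add: g_def norm_divide sum_divide_distrib)
      also have "\<dots> = 1"
        using size[of "r1 m"] unfolding monom_size_def[symmetric] by simp
      finally show ?thesis .
    qed
    ultimately show False by (simp add: LIMSEQ_const_iff)
  qed
  then obtain \<nu>0 where \<nu>0: "\<nu>0 \<in> S" by blast
  then have "\<nu>0 \<in> V" "a \<nu>0 \<noteq> 0" by (auto simp: S_def)
  define y where "y m = z (r1 m)" for m
  have y: "y m $ i \<noteq> 0" for m i using torus by (simp add: y_def)
  have y0: "(\<lambda>m. y m $ i) \<longlonglongrightarrow> 0" for i
    unfolding y_def using LIMSEQ_subseq_LIMSEQ[OF lim0 r1(1)] by (simp add: o_def)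
  have ratio: "(\<lambda>m. norm (zmonom \<nu> (y m)) / norm (zmonom \<nu>0 (y m))) \<longlonglongrightarrow> norm (a \<nu>) / norm (a \<nu>0)"
    if "\<nu> \<in> V" for \<nu>
  proof -
    have "(\<lambda>m. norm (g \<nu> (r1 m)) / norm (g \<nu>0 (r1 m))) \<longlonglongrightarrow> norm (a \<nu>) / norm (a \<nu>0)"
      using \<open>a \<nu>0 \<noteq> 0\<close> by (intro tendsto_divide tendsto_norm a that \<open>\<nu>0 \<in> V\<close>) simp
    moreover have "norm (g \<nu> (r1 m)) / norm (g \<nu>0 (r1 m)) = norm (zmonom \<nu> (y m)) / norm (zmonom \<nu>0 (y m))" for m
      using size[of "r1 m"] by (simp add: g_def y_def norm_divide)
    ultimately show ?thesis by simp
  qed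
  define x where "x m = (\<chi> i. - ln (norm (y m $ i)))" for m
  have x_inner: "x m \<bullet> real_vec \<nu> = - ln (norm (zmonom \<nu> (y m)))" for m \<nu>
    unfolding ln_norm_zmonom[OF y] x_def by (simp add: inner_real_vec sum_negf)
  have "convergent (\<lambda>m. x m \<bullet> (real_vec \<nu>0 - real_vec \<nu>))" if "\<nu> \<in> S" for \<nu>
  proof -
    have "(\<lambda>m. ln (norm (zmonom \<nu> (y m)) / norm (zmonom \<nu>0 (y m)))) \<longlonglongrightarrow> ln (norm (a \<nu>) / norm (a \<nu>0))"
      using that \<nu>0 by (intro tendsto_ln ratio) (auto simp: S_def)
    moreover have "ln (norm (zmonom \<nu> (y m)) / norm (zmonom \<nu>0 (y m))) = x m \<bullet> (real_vec \<nu>0 - real_vec \<nu>)" for m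
      using zmonom_nonzero[OF y] by (simp add: ln_div inner_diff_right x_inner)
    ultimately show ?thesis by (auto simp: convergent_def)
  qed
  then have "\<And>d. d \<in> (\<lambda>\<nu>. real_vec \<nu>0 - real_vec \<nu>) ` S \<Longrightarrow> convergent (\<lambda>m. x m \<bullet> d)" by blast
  then have "\<exists>p. convergent p \<and>
      (\<forall>m. \<forall>d\<in>(\<lambda>\<nu>. real_vec \<nu>0 - real_vec \<nu>) ` S. (x m - p m) \<bullet> d = 0)"
    by (rule convergent_orthogonal_correction)
  then obtain p where p: "convergent p"
    "\<forall>m. \<forall>d\<in>(\<lambda>\<nu>. real_vec \<nu>0 - real_vec \<nu>) ` S. (x m - p m) \<bullet> d = 0"
    by (elim exE conjE)
  define Q where "Q m = x m - p m" for m
  have QS: "Q m \<bullet> real_vec \<nu> = Q m \<bullet> real_vec \<nu>0" if "\<nu> \<in> S" for m \<nu>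
    using p(2)[rule_format, OF imageI[OF that], of m] by (simp add: Q_def inner_diff_right)
  define w where "w m = (\<chi> i. y m $ i * of_real (exp (Q m $ i)))" for m
  have norm_wQ: "norm (w m $ i) = norm (y m $ i) * exp (Q m $ i)" for m i
    by (simp add: w_def norm_mult)
  have norm_w: "norm (w m $ i) = exp (- (p m $ i))" for m i
    unfolding norm_wQ using y[of m i] by (simp add: Q_def x_def exp_diff exp_minus divide_inverse)
  obtain p' where p': "p \<longlonglongrightarrow> p'" using p(1) by (auto simp: convergent_def)
  have norm_w_lim: "(\<lambda>m. norm (w m $ i)) \<longlonglongrightarrow> exp (- (p' $ i))" for i
    unfolding norm_w by (intro tendsto_intros p')
  then have "bounded (range (\<lambda>m. w m $ i))" for i
    using convergent_imp_bounded[OF norm_w_lim[of i]] by (simp add: bounded_iff)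
  then obtain r2 where r2: "strict_mono r2" "\<And>i. convergent (\<lambda>m. w (r2 m) $ i)"
    using common_convergent_subsequence[of UNIV "\<lambda>i m. w m $ i"] by auto
  then obtain w' where w': "\<And>i. (\<lambda>m. w (r2 m) $ i) \<longlonglongrightarrow> w' i" unfolding convergent_def by metis
  define W where "W = (\<chi> i. w' i)"
  have wW: "(\<lambda>m. w (r2 m)) \<longlonglongrightarrow> W" by (rule vec_tendstoI) (use w' in \<open>simp add: W_def\<close>)
  have W_ne: "W $ i \<noteq> 0" for i
  proof -
    have "(\<lambda>m. norm (w (r2 m) $ i)) \<longlonglongrightarrow> exp (- (p' $ i))"
      using LIMSEQ_subseq_LIMSEQ[OF norm_w_lim r2(1)] by (simp add: o_def)
    moreover have "(\<lambda>m. norm (w (r2 m) $ i)) \<longlonglongrightarrow> norm (W $ i)" by (intro tendsto_intros wW)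
    ultimately have "norm (W $ i) = exp (- (p' $ i))" using LIMSEQ_unique by blast
    then show ?thesis by auto
  qed
  have zmonom_w: "zmonom \<nu> (w m) = zmonom \<nu> (y m) * of_real (exp (Q m \<bullet> real_vec \<nu>))" for \<nu> m
    unfolding w_def by (rule zmonom_rescale)
  have zW: "(\<lambda>m. zmonom \<nu> (w (r2 m))) \<longlonglongrightarrow> zmonom \<nu> W" for \<nu>
    by (rule continuous_on_tendsto_compose[OF continuous_on_zmonom[of UNIV] wW]) auto
  define r where "r m = r1 (r2 m)" for m
  have a2: "(\<lambda>m. g \<nu> (r m)) \<longlonglongrightarrow> a \<nu>" if "\<nu> \<in> V" for \<nu>
    unfolding r_def using LIMSEQ_subseq_LIMSEQ[OF a[OF that] r2(1)] by (simp add: o_def)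
  \<comment> \<open>All monomials in \<open>S\<close> carry the same factor, so their limits are those of a single point.\<close>
  define l where "l = a \<nu>0 / zmonom \<nu>0 W"
  have "l \<noteq> 0" using \<open>a \<nu>0 \<noteq> 0\<close> zmonom_nonzero[OF W_ne] by (simp add: l_def)
  have a_eq: "a \<nu> = l * zmonom \<nu> W" if "\<nu> \<in> S" for \<nu>
  proof -
    have "\<nu> \<in> V" using that by (simp add: S_def)
    have "g \<nu> (r m) * zmonom \<nu>0 (w (r2 m)) = g \<nu>0 (r m) * zmonom \<nu> (w (r2 m))" for m
      using QS[OF that, of "r2 m"] by (simp add: g_def zmonom_w y_def r_def)
    moreover have "(\<lambda>m. g \<nu> (r m) * zmonom \<nu>0 (w (r2 m))) \<longlonglongrightarrow> a \<nu> * zmonom \<nu>0 W"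
      by (intro tendsto_mult a2 zW \<open>\<nu> \<in> V\<close>)
    moreover have "(\<lambda>m. g \<nu>0 (r m) * zmonom \<nu> (w (r2 m))) \<longlonglongrightarrow> a \<nu>0 * zmonom \<nu> W"
      by (intro tendsto_mult a2 zW \<open>\<nu>0 \<in> V\<close>)
    ultimately have "a \<nu> * zmonom \<nu>0 W = a \<nu>0 * zmonom \<nu> W" using LIMSEQ_unique by auto
    then show ?thesis using zmonom_nonzero[OF W_ne, of \<nu>0] by (simp add: l_def field_simps)
  qed
  \<comment> \<open>The coordinates of \<open>z\<close> tend to zero while those of \<open>exp(Q) z\<close> do not, so \<open>exp(-Q\<^sub>i)\<close> tends to zero.\<close>
  have pos: "\<forall>\<^sub>F m in sequentially. Q (r2 m) $ i > 0" for i
  proof -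
    have "(\<lambda>m. norm (y (r2 m) $ i) / norm (w (r2 m) $ i)) \<longlonglongrightarrow> 0 / norm (W $ i)"
      using W_ne[of i] LIMSEQ_subseq_LIMSEQ[OF y0 r2(1), of i]
      by (intro tendsto_divide tendsto_norm_zero tendsto_norm tendsto_vec_nth wW) (auto simp: o_def)
    moreover have "norm (y m $ i) / norm (w m $ i) = exp (- (Q m $ i))" for m
      unfolding norm_wQ using y[of m i] by (simp add: exp_minus divide_inverse)
    ultimately have "(\<lambda>m. exp (- (Q (r2 m) $ i))) \<longlonglongrightarrow> 0" by simp
    then have "\<forall>\<^sub>F m in sequentially. exp (- (Q (r2 m) $ i)) < 1" by (rule order_tendstoD) simp
    then show ?thesis by simp
  qed
  \<comment> \<open>For the same reason \<open>Q\<close> separates the monomials that die from those that survive.\<close>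
  have sep: "\<forall>\<^sub>F m in sequentially. Q (r2 m) \<bullet> real_vec \<nu> > Q (r2 m) \<bullet> real_vec \<nu>0" if "\<nu> \<in> V - S" for \<nu>
  proof -
    have "(\<lambda>m. norm (zmonom \<nu> (y (r2 m))) / norm (zmonom \<nu>0 (y (r2 m)))) \<longlonglongrightarrow> 0"
      using that LIMSEQ_subseq_LIMSEQ[OF ratio[of \<nu>] r2(1)] by (simp add: o_def S_def)
    moreover have "(\<lambda>m. norm (zmonom \<nu>0 (w (r2 m))) / norm (zmonom \<nu> (w (r2 m)))) \<longlonglongrightarrow>
        norm (zmonom \<nu>0 W) / norm (zmonom \<nu> W)"
      using zmonom_nonzero[OF W_ne, of \<nu>] by (intro tendsto_intros zW) simp
    ultimately have "(\<lambda>m. norm (zmonom \<nu> (y (r2 m))) / norm (zmonom \<nu>0 (y (r2 m))) *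
        (norm (zmonom \<nu>0 (w (r2 m))) / norm (zmonom \<nu> (w (r2 m))))) \<longlonglongrightarrow>
        0 * (norm (zmonom \<nu>0 W) / norm (zmonom \<nu> W))"
      by (rule tendsto_mult)
    moreover have "norm (zmonom \<nu> (y m)) / norm (zmonom \<nu>0 (y m)) *
        (norm (zmonom \<nu>0 (w m)) / norm (zmonom \<nu> (w m))) =
        exp (Q m \<bullet> real_vec \<nu>0 - Q m \<bullet> real_vec \<nu>)" for m
      using zmonom_nonzero[OF y] by (simp add: zmonom_w norm_mult exp_diff)
    ultimately have "(\<lambda>m. exp (Q (r2 m) \<bullet> real_vec \<nu>0 - Q (r2 m) \<bullet> real_vec \<nu>)) \<longlonglongrightarrow> 0" by simp
    then have "\<forall>\<^sub>F m in sequentially. exp (Q (r2 m) \<bullet> real_vec \<nu>0 - Q (r2 m) \<bullet> real_vec \<nu>) < 1"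
      by (rule order_tendstoD) simp
    then show ?thesis by simp
  qed
  have "\<forall>\<^sub>F m in sequentially. (\<forall>i. Q (r2 m) $ i > 0) \<and>
      (\<forall>\<nu>\<in>V - S. Q (r2 m) \<bullet> real_vec \<nu> > Q (r2 m) \<bullet> real_vec \<nu>0)"
    using pos sep V(1) by (intro eventually_conj eventually_all_finite eventually_ball_finite) auto
  then obtain m where m: "\<And>i. Q (r2 m) $ i > 0"
      "\<And>\<nu>. \<nu> \<in> V - S \<Longrightarrow> Q (r2 m) \<bullet> real_vec \<nu> > Q (r2 m) \<bullet> real_vec \<nu>0"
    using eventually_happens'[OF sequentially_bot] by blast
  show ?thesis
  proof (rule that[of r S "Q (r2 m)" W l "Q (r2 m) \<bullet> real_vec \<nu>0"])
    show "strict_mono r" unfolding r_def using r1(1) r2(1) by (simp add: strict_mono_def)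
    fix \<nu> assume "\<nu> \<in> V"
    then have "a \<nu> = (if \<nu> \<in> S then l * zmonom \<nu> W else 0)" using a_eq by (auto simp: S_def)
    then show "(\<lambda>m. zmonom \<nu> (z (r m)) / of_real (monom_size V (z (r m))))
        \<longlonglongrightarrow> (if \<nu> \<in> S then l * zmonom \<nu> W else 0)"
      using a2[OF \<open>\<nu> \<in> V\<close>] by (simp add: g_def)
  qed (use S_ne m W_ne \<open>l \<noteq> 0\<close> QS in \<open>auto simp: S_def\<close>)
qed

section \<open>The Newton polyhedron\<close>

lemma real_vec_in_newton_polyhedron:
  "c \<nu> \<noteq> 0 \<Longrightarrow> real_vec \<nu> \<in> newton_polyhedron c"
  unfolding newton_polyhedron_def by (rule hull_inc) (force intro: image_eqI[where x = 0])

lemma newton_polyhedron_inner_ge: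
  assumes P: "\<And>i. P $ i > 0" and d: "\<And>\<nu>. c \<nu> \<noteq> 0 \<Longrightarrow> d \<le> P \<bullet> real_vec \<nu>"
    and x: "x \<in> newton_polyhedron c"
  shows "d \<le> P \<bullet> x"
proof -
  have "newton_polyhedron c \<subseteq> {x. d \<le> P \<bullet> x}"
    unfolding newton_polyhedron_def
  proof (rule hull_minimal)
    show "convex {x. d \<le> P \<bullet> x}" by (rule convex_halfspace_ge)
    show "(\<Union>\<nu>\<in>{\<nu>. c \<nu> \<noteq> 0}. (\<lambda>x. real_vec \<nu> + x) ` {x. \<forall>i. 0 \<le> x $ i}) \<subseteq> {x. d \<le> P \<bullet> x}"
    proof clarsimp
      fix \<nu> :: "nat ^ 'a" and x :: "real ^ 'a" assume "c \<nu> \<noteq> 0" "\<forall>i. 0 \<le> x $ i"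
      then have "d \<le> P \<bullet> real_vec \<nu>" "0 \<le> P \<bullet> x"
        using d P by (auto simp: inner_vec_def less_imp_le intro!: sum_nonneg)
      then show "d \<le> P \<bullet> (real_vec \<nu> + x)" by (simp add: inner_add_right)
    qed
  qed
  then show ?thesis using x by auto
qed

text \<open>
  To recognise the face of a positive weight it suffices to know where the weight is minimal on the support,
  because positive weights can only increase along the orthant. The face contains finitely many lattice
  points, as the sum defining the face function requires.
\<close>

lemma face_function_eq_sum:
  assumes P: "\<And>i. P $ i > 0" and S: "S \<noteq> {}" "\<And>\<nu>. \<nu> \<in> S \<Longrightarrow> c \<nu> \<noteq> 0"
    and on: "\<And>\<nu>. \<nu> \<in> S \<Longrightarrow> P \<bullet> real_vec \<nu> = d"
    and off: "\<And>\<nu>. c \<nu> \<noteq> 0 \<Longrightarrow> \<nu> \<notin> S \<Longrightarrow> P \<bullet> real_vec \<nu> > d"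
  shows "finite S" "face_function c P = (\<lambda>z. \<Sum>\<nu>\<in>S. c \<nu> * zmonom \<nu> z)"
proof -
  have ge: "d \<le> P \<bullet> x" if "x \<in> newton_polyhedron c" for x
    by (rule newton_polyhedron_inner_ge[OF P _ that]) (use on off in force)
  obtain \<nu>0 where \<nu>0: "\<nu>0 \<in> S" using S by blast
  have face: "x \<in> weight_face c P \<longleftrightarrow> x \<in> newton_polyhedron c \<and> P \<bullet> x = d" for x
  proof -
    have "x \<in> weight_face c P \<longleftrightarrow> x \<in> newton_polyhedron c \<and> (\<forall>y\<in>newton_polyhedron c. P \<bullet> x \<le> P \<bullet> y)"
      by (simp add: weight_face_def inner_vec_def)
    then show ?thesis
      using ge real_vec_in_newton_polyhedron[of c \<nu>0] S(2)[OF \<nu>0] on[OF \<nu>0] by (metis order_antisym)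
  qed
  have fin: "finite {\<nu>. real_vec \<nu> \<in> weight_face c P}"
  proof (rule finite_subset[OF _ finite_mdeg_le])
    show "{\<nu>. real_vec \<nu> \<in> weight_face c P} \<subseteq> {\<nu>. mdeg \<nu> \<le> nat \<lceil>\<Sum>i\<in>UNIV. d / P $ i\<rceil>}"
    proof clarify
      fix \<nu> assume "real_vec \<nu> \<in> weight_face c P"
      then have d: "(\<Sum>i\<in>UNIV. P $ i * real (\<nu> $ i)) = d" by (simp add: face inner_real_vec)
      have "real (\<nu> $ i) \<le> d / P $ i" for i
      proof -
        have "P $ i * real (\<nu> $ i) \<le> d"
          unfolding d[symmetric] using P by (intro member_le_sum) (auto simp: less_imp_le)
        then show ?thesis using P[of i] by (simp add: field_simps)
      qed
      then have "real (mdeg \<nu>) \<le> (\<Sum>i\<in>UNIV. d / P $ i)" by (simp add: mdeg_def sum_mono)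
      then show "mdeg \<nu> \<le> nat \<lceil>\<Sum>i\<in>UNIV. d / P $ i\<rceil>" by linarith
    qed
  qed
  have sub: "S \<subseteq> {\<nu>. real_vec \<nu> \<in> weight_face c P}"
    using face on S(2) real_vec_in_newton_polyhedron by blast
  then show "finite S" using fin finite_subset by blast
  show "face_function c P = (\<lambda>z. \<Sum>\<nu>\<in>S. c \<nu> * zmonom \<nu> z)"
  proof
    fix z
    show "face_function c P z = (\<Sum>\<nu>\<in>S. c \<nu> * zmonom \<nu> z)"
      unfolding face_function_def
    proof (rule sum.mono_neutral_right[OF fin sub], rule ballI)
      fix \<nu> assume "\<nu> \<in> {\<nu>. real_vec \<nu> \<in> weight_face c P} - S"
      then have "\<nu> \<notin> S" "P \<bullet> real_vec \<nu> = d" by (auto simp: face)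
      then show "c \<nu> * zmonom \<nu> z = 0" using off by force
    qed
  qed
qed

text \<open>
  Two facts pin down the point of the boundary on an axis. A point of the polyhedron on the \<open>j\<close>-th axis can
  only be a convex combination of points on that axis, because coordinates in the orthant do not
  cancel; so some pure power of exponent at most \<open>b\<close> occurs in the support. Were there one of exponent
  less than \<open>b\<close>, then every face through the axis point of height \<open>b\<close> would contain the
  whole ray of the axis beyond that point and could not be compact.
\<close>

lemma pure_power_on_newton_boundary:
  fixes c :: "nat ^ 'n \<Rightarrow> complex"
  assumes "axis j (real b) \<in> newton_boundary c"
  shows "c (axis j b) \<noteq> 0" "\<And>n. c (axis j n) \<noteq> 0 \<Longrightarrow> b \<le> n"
proof -
  let ?N = "newton_polyhedron c"
  obtain F where F: "F face_of ?N" "compact F" "axis j (real b) \<in> F"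
    using assms by (auto simp: newton_boundary_def)
  have ray: "axis j t \<in> ?N" if "c (axis j n) \<noteq> 0" "real n \<le> t" for n t
  proof -
    have "axis j t = real_vec (axis j n) + axis j (t - real n)"
      by (simp add: real_vec_def axis_def vec_eq_iff)
    moreover have "\<forall>i. 0 \<le> axis j (t - real n) $ i" using that by (simp add: axis_def)
    ultimately show ?thesis
      unfolding newton_polyhedron_def using that(1) by (intro hull_inc) blast
  qed
  show min: "b \<le> n" if n: "c (axis j n) \<noteq> 0" for n
  proof (rule ccontr)
    assume "\<not> b \<le> n"
    then have lt: "real n < real b" by simp
    have inF: "axis j t \<in> F" if t: "t > real b" for t
    proof -
      \<comment> \<open>The parameter at which the segment from height \<open>n\<close> to height \<open>t\<close> passes through height \<open>b\<close>.\<close>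
      define s where "s = (real b - real n) / (t - real n)"
      have s: "0 < s" "s < 1" using lt t by (simp_all add: s_def)
      have "s * (t - real n) = real b - real n" using lt t by (simp add: s_def)
      then have "real b = (1 - s) * real n + s * t" by (simp add: algebra_simps)
      then have "axis j (real b) = (1 - s) *\<^sub>R axis j (real n) + s *\<^sub>R axis j t"
        by (simp add: axis_def vec_eq_iff)
      moreover have "axis j (real n) \<noteq> axis j t" using lt t by (simp add: axis_eq_axis)
      ultimately have "axis j (real b) \<in> open_segment (axis j (real n)) (axis j t)"
        using s unfolding in_segment by blast
      then show ?thesis
        using face_ofD[OF F(1) _ ray[OF n] ray[OF n] F(3)] lt t by auto
    qed
    obtain R where R: "\<And>x. x \<in> F \<Longrightarrow> norm x \<le> R"
      using compact_imp_bounded[OF F(2)] by (auto simp: bounded_iff)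
    have "norm (axis j (real b + \<bar>R\<bar> + 1)) \<le> R" by (intro R inF) simp
    moreover have "\<bar>axis j (real b + \<bar>R\<bar> + 1) $ j\<bar> \<le> norm (axis j (real b + \<bar>R\<bar> + 1))"
      by (rule component_le_norm_cart)
    ultimately show False by simp
  qed
  have "\<exists>n. n \<le> b \<and> c (axis j n) \<noteq> 0"
  proof (rule ccontr)
    assume no: "\<not> ?thesis"
    \<comment> \<open>\<open>H\<close> is convex although its defining implication is not a linear inequality: a proper convex
      combination lies on the axis only if both of its ingredients do.\<close>
    define H where "H = {x :: real ^ 'n. (\<forall>i. 0 \<le> x $ i) \<and> ((\<forall>i. i \<noteq> j \<longrightarrow> x $ i = 0) \<longrightarrow> real b < x $ j)}"
    have "?N \<subseteq> H"
      unfolding newton_polyhedron_def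
    proof (rule hull_minimal)
      show "(\<Union>\<nu>\<in>{\<nu>. c \<nu> \<noteq> 0}. (\<lambda>x. real_vec \<nu> + x) ` {x. \<forall>i. 0 \<le> x $ i}) \<subseteq> H"
      proof clarify
        fix \<nu> :: "nat ^ 'n" and x :: "real ^ 'n" assume \<nu>: "c \<nu> \<noteq> 0" and x: "\<forall>i. 0 \<le> x $ i"
        have "real b < (real_vec \<nu> + x) $ j" if off: "\<forall>i. i \<noteq> j \<longrightarrow> (real_vec \<nu> + x) $ i = 0"
        proof -
          have "\<nu> $ i = 0" if "i \<noteq> j" for i
            using off[rule_format, OF that] x[rule_format, of i] by (simp add: real_vec_def)
          then have "\<nu> = axis j (\<nu> $ j)" by (simp add: vec_eq_iff axis_def)
          then have "b < \<nu> $ j" using no \<nu> by (metis not_less)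
          then show ?thesis using x[rule_format, of j] by (simp add: real_vec_def)
        qed
        then show "real_vec \<nu> + x \<in> H" using x by (simp add: H_def real_vec_def)
      qed
      show "convex H"
      proof (rule convexI)
        fix x y :: "real ^ 'n" and u v :: real
        assume xy: "x \<in> H" "y \<in> H" and uv: "0 \<le> u" "0 \<le> v" "u + v = 1"
        show "u *\<^sub>R x + v *\<^sub>R y \<in> H"
        proof (cases "u = 0 \<or> v = 0")
          case True
          then show ?thesis using xy uv by auto
        next
          case False
          then have pos: "u > 0" "v > 0" using uv by auto
          have nn: "0 \<le> u * x $ i" "0 \<le> v * y $ i" for i using xy pos by (auto simp: H_def)
          have "real b < u * x $ j + v * y $ j" if off: "\<forall>i. i \<noteq> j \<longrightarrow> u * x $ i + v * y $ i = 0"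
          proof -
            have "x $ i = 0 \<and> y $ i = 0" if "i \<noteq> j" for i
              using off[rule_format, OF that] nn[of i] pos by (simp add: add_nonneg_eq_0_iff)
            then have "real b < x $ j" "real b < y $ j" using xy by (auto simp: H_def)
            then have "u * real b + v * real b < u * x $ j + v * y $ j"
              using pos by (intro add_strict_mono) auto
            then show ?thesis using uv(3) by (simp flip: distrib_right)
          qed
          then show ?thesis using nn by (simp add: H_def)
        qed
      qed
    qed
    moreover have "axis j (real b) \<in> ?N" using F face_of_imp_subset by blast
    ultimately show False by (auto simp: H_def axis_def)
  qed
  then show "c (axis j b) \<noteq> 0" using min by (metis le_antisym)
qed

section \<open>The gradient dominates the Newton monomials\<close>

lemma attained_component_bound:
  fixes z :: "complex ^ 'n"
  obtains j where "\<And>i. norm (z $ i) \<le> norm (z $ j)"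
proof -
  have "Max (range (\<lambda>i. norm (z $ i))) \<in> range (\<lambda>i. norm (z $ i))" by (rule Max_in) auto
  then obtain j where "Max (range (\<lambda>i. norm (z $ i))) = norm (z $ j)" by blast
  moreover have "norm (z $ i) \<le> Max (range (\<lambda>i. norm (z $ i)))" for i by (rule Max_ge) auto
  ultimately show ?thesis by (intro that[of j]) simp
qed

text \<open>
  All exponents of degree at most \<open>B\<close> are kept, rather than only vertices of the polyhedron or minimal
  elements of the support: finiteness is then immediate, and the remaining terms are controlled by
  degree alone.
\<close>

definition low_support :: "(nat ^ 'n \<Rightarrow> complex) \<Rightarrow> nat \<Rightarrow> (nat ^ 'n) set" where
  "low_support c B = {\<nu>. c \<nu> \<noteq> 0 \<and> mdeg \<nu> \<le> B}"

lemma finite_low_support: "finite (low_support c B)"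
  by (rule finite_subset[OF _ finite_mdeg_le[of B]]) (auto simp: low_support_def)

lemma component_power_le_size:
  assumes "c (axis i b) \<noteq> 0" "b \<le> B" "norm (z $ i) \<le> 1"
  shows "norm (z $ i) ^ B \<le> monom_size (low_support c B) z"
proof -
  have "norm (z $ i) ^ B \<le> norm (z $ i) ^ b" using assms by (intro power_decreasing) auto
  also have "\<dots> = norm (zmonom (axis i b) z)" by (simp add: norm_power)
  also have "\<dots> \<le> monom_size (low_support c B) z"
    using assms by (intro norm_zmonom_le_size finite_low_support) (simp add: low_support_def)
  finally show ?thesis .
qed

text \<open>
  Compare with the pure power in the direction of the smallest weight \<open>P\<^sub>i\<close>: its value is at most
  \<open>B P\<^sub>i\<close>, whereas degree greater than \<open>B\<close> forces a value greater than \<open>B P\<^sub>i\<close>.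
\<close>

lemma inner_beyond_low_degree:
  assumes P: "\<And>i. P $ i > 0" and b: "\<And>i. b i \<le> B"
    and d: "\<And>i. d \<le> P \<bullet> real_vec (axis i (b i))" and deg: "B < mdeg \<nu>"
  shows "d < P \<bullet> real_vec \<nu>"
proof -
  have "Min (range (\<lambda>i. P $ i)) \<in> range (\<lambda>i. P $ i)" by (rule Min_in) auto
  then obtain i0 where i0: "Min (range (\<lambda>i. P $ i)) = P $ i0" by blast
  have least: "P $ i0 \<le> P $ i" for i unfolding i0[symmetric] by (rule Min_le) auto
  have "P \<bullet> real_vec (axis i0 (b i0)) = P $ i0 * real (b i0)"
    by (simp add: inner_real_vec axis_def if_distrib cong: if_cong)
  then have "d \<le> P $ i0 * real (b i0)" using d[of i0] by simp
  also have "\<dots> < P $ i0 * real (mdeg \<nu>)"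
    using P[of i0] b[of i0] deg by (intro mult_strict_left_mono) auto
  also have "\<dots> = (\<Sum>i\<in>UNIV. P $ i0 * real (\<nu> $ i))" by (simp add: mdeg_def sum_distrib_left)
  also have "\<dots> \<le> P \<bullet> real_vec \<nu>"
    unfolding inner_real_vec by (intro sum_mono mult_right_mono least) auto
  finally show ?thesis .
qed

context dominated_series
begin

text \<open>
  The factor \<open>\<gamma>\<close> is \<open>1\<close> for \<open>f\<close> itself and \<open>\<nu>\<^sub>i\<close> for \<open>z\<^sub>i \<partial>\<^sub>i f\<close>.
\<close>

lemma truncation_bound:
  "\<exists>K\<ge>0. \<forall>\<gamma> E z s. (\<forall>\<nu>. norm (\<gamma> \<nu>) \<le> real (mdeg \<nu>) + 1) \<longrightarrow> (\<forall>i. norm (z $ i) \<le> s) \<longrightarrow> s \<le> \<rho> \<longrightarrow>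
     ((\<lambda>\<nu>. \<gamma> \<nu> * c \<nu> * zmonom \<nu> z) has_sum E) UNIV \<longrightarrow>
     norm (E - (\<Sum>\<nu>\<in>low_support c B. \<gamma> \<nu> * c \<nu> * zmonom \<nu> z)) \<le> K * s ^ Suc B"
proof -
  obtain K where K: "K \<ge> 0" "\<And>h S s. 0 \<le> s \<Longrightarrow> s \<le> \<rho> \<Longrightarrow> (h has_sum S) UNIV \<Longrightarrow>
    (\<forall>\<nu>. norm (h \<nu>) \<le> (real (mdeg \<nu>) + 1) * norm (c \<nu>) * s ^ (mdeg \<nu> - 0)) \<Longrightarrow>
    (\<forall>\<nu>. mdeg \<nu> < Suc B + 0 \<longrightarrow> h \<nu> = 0) \<Longrightarrow> norm (S :: complex) \<le> K * s ^ Suc B"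
    using high_order_bound[of 0 "Suc B"] by auto
  show ?thesis
  proof (intro exI[of _ K] conjI allI impI K)
    fix \<gamma> :: "nat ^ 'n \<Rightarrow> complex" and E s and z :: "complex ^ 'n"
    assume \<gamma>: "\<forall>\<nu>. norm (\<gamma> \<nu>) \<le> real (mdeg \<nu>) + 1" and z: "\<forall>i. norm (z $ i) \<le> s" and s: "s \<le> \<rho>"
      and E: "((\<lambda>\<nu>. \<gamma> \<nu> * c \<nu> * zmonom \<nu> z) has_sum E) UNIV"
    define t where "t \<nu> = \<gamma> \<nu> * c \<nu> * zmonom \<nu> z" for \<nu>
    define t' where "t' \<nu> = (if \<nu> \<in> low_support c B then t \<nu> else 0)" for \<nu>
    show s0: "0 \<le> s" using z norm_ge_zero order_trans by blast
    show "s \<le> \<rho>" by fact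
    have "(t' has_sum (\<Sum>\<nu>\<in>low_support c B. t \<nu>)) UNIV"
      by (rule has_sum_finite_neutralI[OF finite_low_support[of c B]]) (auto simp: t'_def)
    then have "((\<lambda>\<nu>. - 1 * t' \<nu>) has_sum (- 1 * (\<Sum>\<nu>\<in>low_support c B. t \<nu>))) UNIV"
      by (rule has_sum_cmult_right)
    then show "((\<lambda>\<nu>. t \<nu> - t' \<nu>) has_sum
        (E - (\<Sum>\<nu>\<in>low_support c B. \<gamma> \<nu> * c \<nu> * zmonom \<nu> z))) UNIV"
      using has_sum_add[OF E[folded t_def]] unfolding t_def[symmetric] by fastforce
    fix \<nu> :: "nat ^ 'n"
    have "norm (t \<nu>) \<le> (real (mdeg \<nu>) + 1) * norm (c \<nu>) * s ^ mdeg \<nu>"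
      unfolding t_def norm_mult using \<gamma> z s0 by (intro mult_mono norm_zmonom_le) auto
    moreover have "norm (t \<nu> - t' \<nu>) \<le> norm (t \<nu>)" by (simp add: t'_def)
    ultimately show "norm (t \<nu> - t' \<nu>) \<le> (real (mdeg \<nu>) + 1) * norm (c \<nu>) * s ^ (mdeg \<nu> - 0)" by simp
    show "t \<nu> - t' \<nu> = 0" if "mdeg \<nu> < Suc B + 0"
      using that by (auto simp: t'_def t_def low_support_def)
  qed
qed

text \<open>
  A sequence violating the estimate degenerates, by \<open>toric_limit\<close>, to a point of the torus at
  which all Euler derivatives of a face function vanish, contrary to non-degeneracy.
\<close>

lemma euler_sum_lower_bound_on_torus:
  assumes nd: "nondegenerate c" and b: "\<And>i. c (axis i (b i)) \<noteq> 0" "\<And>i. b i \<le> B"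
  shows "\<exists>\<kappa>>0. \<exists>\<delta>>0. \<forall>z. (\<forall>i. z $ i \<noteq> 0 \<and> norm (z $ i) < \<delta>) \<longrightarrow>
    \<kappa> * monom_size (low_support c B) z \<le> (\<Sum>i\<in>UNIV. norm (z $ i * partial_deriv i f z))"
proof (rule ccontr)
  define V where "V = low_support c B"
  define \<epsilon> where "\<epsilon> m = inverse (real (Suc m))" for m
  assume no: "\<not> ?thesis"
  have "\<exists>z. (\<forall>i. z $ i \<noteq> 0 \<and> norm (z $ i) < \<epsilon> m) \<and>
      (\<Sum>i\<in>UNIV. norm (z $ i * partial_deriv i f z)) < \<epsilon> m * monom_size V z" for m
  proof -
    have "\<epsilon> m > 0" by (simp add: \<epsilon>_def)
    then show ?thesis using no unfolding V_def by (meson not_le)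
  qed
  then obtain Z where Z: "\<And>m i. Z m $ i \<noteq> 0" "\<And>m i. norm (Z m $ i) < \<epsilon> m"
    "\<And>m. (\<Sum>i\<in>UNIV. norm (Z m $ i * partial_deriv i f (Z m))) < \<epsilon> m * monom_size V (Z m)" by metis
  have \<epsilon>0: "\<epsilon> \<longlonglongrightarrow> 0" unfolding \<epsilon>_def by (rule LIMSEQ_inverse_real_of_nat)
  have Z0: "(\<lambda>m. Z m $ i) \<longlonglongrightarrow> 0" for i
    by (rule Lim_null_comparison[OF always_eventually \<epsilon>0]) (use Z(2) in \<open>auto intro: less_imp_le\<close>)
  have "axis i (b i) \<in> V" for i using b by (simp add: V_def low_support_def)
  then have V: "finite V" "V \<noteq> {}" by (auto simp: V_def finite_low_support)
  show False
  proof (rule toric_limit[OF V Z(1) Z0])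
    fix r S P w l d
    assume r: "strict_mono (r :: nat \<Rightarrow> nat)" and S: "S \<subseteq> V" "S \<noteq> {}"
      and P: "\<And>i. P $ i > 0" and w: "\<And>i. w $ i \<noteq> 0" and l: "l \<noteq> 0"
      and on: "\<And>\<nu>. \<nu> \<in> S \<Longrightarrow> P \<bullet> real_vec \<nu> = d" and off: "\<And>\<nu>. \<nu> \<in> V - S \<Longrightarrow> P \<bullet> real_vec \<nu> > d"
      and lim: "\<And>\<nu>. \<nu> \<in> V \<Longrightarrow> (\<lambda>m. zmonom \<nu> (Z (r m)) / of_real (monom_size V (Z (r m))))
          \<longlonglongrightarrow> (if \<nu> \<in> S then l * zmonom \<nu> w else 0)"
    have low: "d \<le> P \<bullet> real_vec (axis i (b i))" for i
    proof -
      have "axis i (b i) \<in> V" using b by (simp add: V_def low_support_def)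
      then show ?thesis using on off by (metis DiffI less_imp_le order_refl)
    qed
    have off': "P \<bullet> real_vec \<nu> > d" if "c \<nu> \<noteq> 0" "\<nu> \<notin> S" for \<nu>
    proof (cases "mdeg \<nu> \<le> B")
      case True
      then show ?thesis using off that by (simp add: V_def low_support_def)
    next
      case False
      then show ?thesis using inner_beyond_low_degree[OF P b(2) low] by simp
    qed
    have S': "\<And>\<nu>. \<nu> \<in> S \<Longrightarrow> c \<nu> \<noteq> 0" using S by (auto simp: V_def low_support_def)
    have fin: "finite S"
      by (rule face_function_eq_sum(1)[OF P S(2)]) (fact S' on off')+
    have face: "face_function c P = (\<lambda>z. \<Sum>\<nu>\<in>S. c \<nu> * zmonom \<nu> z)"
      by (rule face_function_eq_sum(2)[OF P S(2)]) (fact S' on off')+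
    \<comment> \<open>The truncated Euler derivative divided by \<open>M\<close> tends to zero by the choice of the sequence; its limit is
      also \<open>l\<close> times the Euler derivative of the face function at \<open>w\<close>.\<close>
    have zero: "(\<Sum>\<nu>\<in>S. of_nat (\<nu> $ i) * c \<nu> * zmonom \<nu> w) = 0" for i
    proof -
      obtain K where K: "K \<ge> 0" "\<And>\<gamma> E z s. (\<forall>\<nu>. norm (\<gamma> \<nu>) \<le> real (mdeg \<nu>) + 1) \<Longrightarrow> (\<forall>i. norm (z $ i) \<le> s) \<Longrightarrow> s \<le> \<rho> \<Longrightarrow>
       ((\<lambda>\<nu>. \<gamma> \<nu> * c \<nu> * zmonom \<nu> z) has_sum E) UNIV \<Longrightarrow>
       norm (E - (\<Sum>\<nu>\<in>low_support c B. \<gamma> \<nu> * c \<nu> * zmonom \<nu> z)) \<le> K * s ^ Suc B"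
        using truncation_bound[of B] by auto
      define T where "T z = (\<Sum>\<nu>\<in>V. of_nat (\<nu> $ i) * c \<nu> * zmonom \<nu> z)" for z
      have bound: "norm (T (Z m) / of_real (monom_size V (Z m))) \<le> (1 + K) * \<epsilon> m" if small: "\<epsilon> m < \<rho>" for m
      proof -
        obtain j where j: "\<And>i. norm (Z m $ i) \<le> norm (Z m $ j)" using attained_component_bound by blast
        define s where "s = norm (Z m $ j)"
        have s: "0 \<le> s" "s \<le> \<epsilon> m" "s \<le> \<rho>" using Z(2)[of m j] small by (auto simp: s_def)
        have "\<epsilon> m \<le> 1" by (simp add: \<epsilon>_def inverse_le_1_iff)
        then have sB: "s ^ B \<le> monom_size V (Z m)"
          unfolding s_def V_def using b s(2) by (intro component_power_le_size[of c j "b j"]) (auto simp: s_def)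
        have in_disc: "norm (Z m $ i) < \<rho>" for i using Z(2)[of m i] small by simp
        have "real (\<nu> $ i) \<le> real (mdeg \<nu>) + 1" for \<nu> using exponent_le_mdeg[of \<nu> i] by simp
        then have "norm (Z m $ i * partial_deriv i f (Z m) - T (Z m)) \<le> K * s ^ Suc B"
          unfolding T_def V_def using j s(3) has_sum_euler_deriv[OF in_disc, of i]
          by (intro K(2)) (auto simp: s_def)
        also have "\<dots> \<le> K * (\<epsilon> m * monom_size V (Z m))"
          using K(1) s sB by (auto intro!: mult_left_mono mult_mono)
        finally have "norm (Z m $ i * partial_deriv i f (Z m) - T (Z m)) \<le> K * (\<epsilon> m * monom_size V (Z m))" .
        moreover have "norm (Z m $ i * partial_deriv i f (Z m)) \<le> \<epsilon> m * monom_size V (Z m)"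
          using Z(3)[of m] member_le_sum[of i UNIV "\<lambda>i. norm (Z m $ i * partial_deriv i f (Z m))"] by simp
        moreover have "norm (T (Z m)) \<le> norm (Z m $ i * partial_deriv i f (Z m)) +
            norm (Z m $ i * partial_deriv i f (Z m) - T (Z m))"
          by (metis norm_minus_commute norm_triangle_sub)
        ultimately have "norm (T (Z m)) \<le> (1 + K) * \<epsilon> m * monom_size V (Z m)"
          by (simp add: algebra_simps)
        moreover have "monom_size V (Z m) > 0" using V Z(1) by (intro monom_size_pos)
        ultimately show ?thesis by (simp add: norm_divide divide_le_eq)
      qed
      have \<epsilon>r: "(\<lambda>m. \<epsilon> (r m)) \<longlonglongrightarrow> 0" using LIMSEQ_subseq_LIMSEQ[OF \<epsilon>0 r] by (simp add: o_def)
      have "(\<lambda>m. T (Z (r m)) / of_real (monom_size V (Z (r m)))) \<longlonglongrightarrow> 0"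
      proof (rule Lim_null_comparison)
        have "\<forall>\<^sub>F m in sequentially. \<epsilon> (r m) < \<rho>" by (rule order_tendstoD(2)[OF \<epsilon>r radius_pos])
        then show "\<forall>\<^sub>F m in sequentially. norm (T (Z (r m)) / of_real (monom_size V (Z (r m)))) \<le> (1 + K) * \<epsilon> (r m)"
          by eventually_elim (rule bound)
        show "(\<lambda>m. (1 + K) * \<epsilon> (r m)) \<longlonglongrightarrow> 0" using tendsto_mult_right_zero[OF \<epsilon>r] .
      qed
      moreover have "(\<lambda>m. T (Z (r m)) / of_real (monom_size V (Z (r m)))) \<longlonglongrightarrow>
          (\<Sum>\<nu>\<in>V. of_nat (\<nu> $ i) * c \<nu> * (if \<nu> \<in> S then l * zmonom \<nu> w else 0))"
      proof -
        have "(\<lambda>m. \<Sum>\<nu>\<in>V. of_nat (\<nu> $ i) * c \<nu> * (zmonom \<nu> (Z (r m)) / of_real (monom_size V (Z (r m))))) \<longlonglongrightarrow>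
          (\<Sum>\<nu>\<in>V. of_nat (\<nu> $ i) * c \<nu> * (if \<nu> \<in> S then l * zmonom \<nu> w else 0))"
          by (intro tendsto_sum tendsto_mult tendsto_const lim)
        then show ?thesis by (simp add: T_def sum_divide_distrib)
      qed
      ultimately have "0 = (\<Sum>\<nu>\<in>V. of_nat (\<nu> $ i) * c \<nu> * (if \<nu> \<in> S then l * zmonom \<nu> w else 0))"
        using LIMSEQ_unique by blast
      also have "\<dots> = (\<Sum>\<nu>\<in>S. of_nat (\<nu> $ i) * c \<nu> * (l * zmonom \<nu> w))"
        using S V by (intro sum.mono_neutral_cong_right) auto
      also have "\<dots> = l * (\<Sum>\<nu>\<in>S. of_nat (\<nu> $ i) * c \<nu> * zmonom \<nu> w)"
        by (simp add: sum_distrib_left mult_ac)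
      finally show ?thesis using l by simp
    qed
    have "gradient (face_function c P) w = 0"
    proof -
      have "w $ i * partial_deriv i (face_function c P) w = 0" for i
      proof -
        have "w $ i * partial_deriv i (face_function c P) w = (\<Sum>\<nu>\<in>S. c \<nu> * (w $ i * deriv_monom i \<nu> w))"
          unfolding face partial_deriv_polynomial[OF fin] by (simp add: sum_distrib_left mult_ac)
        then show ?thesis using zero[of i] by (simp add: euler_deriv_monom mult_ac)
      qed
      then show ?thesis using w by (simp add: gradient_def vec_eq_iff)
    qed
    then show False using nd P w by (auto simp: nondegenerate_def)
  qed
qed

lemma euler_sum_lower_bound:
  assumes nd: "nondegenerate c" and b: "\<And>i. c (axis i (b i)) \<noteq> 0" "\<And>i. b i \<le> B"
  shows "\<exists>\<kappa>>0. \<exists>\<delta>>0. \<forall>z. (\<forall>i. norm (z $ i) < \<delta>) \<longrightarrow>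
    \<kappa> * monom_size (low_support c B) z \<le> (\<Sum>i\<in>UNIV. norm (z $ i * partial_deriv i f z))"
proof -
  define V where "V = low_support c B"
  obtain \<kappa> \<delta> where \<kappa>: "\<kappa> > 0" and \<delta>: "\<delta> > 0" and
    tor: "\<And>z. (\<forall>i. z $ i \<noteq> 0 \<and> norm (z $ i) < \<delta>) \<Longrightarrow>
      \<kappa> * monom_size V z \<le> (\<Sum>i\<in>UNIV. norm (z $ i * partial_deriv i f z))"
    unfolding V_def using euler_sum_lower_bound_on_torus[of b B] nd b by blast
  define D where "D = {z :: complex ^ 'n. \<forall>i. norm (z $ i) < min \<delta> \<rho>}"
  define F where "F z = (\<Sum>i\<in>UNIV. norm (z $ i * partial_deriv i f z)) - \<kappa> * monom_size V z" for z
  have euler: "continuous_on D (\<lambda>z. z $ i * partial_deriv i f z)" for i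
    by (rule continuous_on_subset[OF continuous_on_euler_deriv]) (auto simp: D_def)
  have contF: "continuous_on D F"
    unfolding F_def monom_size_def
    by (intro continuous_on_diff continuous_on_sum continuous_on_norm euler continuous_on_mult_left
        continuous_on_zmonom)
  have "F z \<ge> 0" if z: "z \<in> D" for z
  proof -
    \<comment> \<open>A small displacement along the diagonal leaves every coordinate hyperplane.\<close>
    define e where "e m = ((\<chi> i. of_real (inverse (real (Suc m)))) :: complex ^ 'n)" for m
    have "(\<lambda>m. of_real (inverse (real (Suc m))) :: complex) \<longlonglongrightarrow> of_real 0"
      by (intro tendsto_of_real LIMSEQ_inverse_real_of_nat)
    then have "e \<longlonglongrightarrow> 0" by (intro vec_tendstoI) (simp add: e_def)
    then have lim: "(\<lambda>m. z + e m) \<longlonglongrightarrow> z" using tendsto_add[OF tendsto_const[of z]] by fastforce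
    have lim_i: "(\<lambda>m. (z + e m) $ i) \<longlonglongrightarrow> z $ i" for i by (intro tendsto_vec_nth lim)
    have "\<forall>\<^sub>F m in sequentially. \<forall>i. norm ((z + e m) $ i) < min \<delta> \<rho>"
      using z by (intro eventually_all_finite order_tendstoD(2)[OF tendsto_norm[OF lim_i]]) (auto simp: D_def)
    then have inD: "\<forall>\<^sub>F m in sequentially. z + e m \<in> D" by (simp add: D_def)
    have "\<forall>\<^sub>F m in sequentially. (z + e m) $ i \<noteq> 0" for i
    proof (cases "z $ i = 0")
      case True
      then show ?thesis by (simp add: e_def del: of_nat_Suc)
    next
      case False
      then show ?thesis using lim_i tendsto_imp_eventually_ne by blast
    qed
    then have "\<forall>\<^sub>F m in sequentially. \<forall>i. (z + e m) $ i \<noteq> 0" by (intro eventually_all_finite)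
    with inD have "\<forall>\<^sub>F m in sequentially. F (z + e m) \<ge> 0"
    proof eventually_elim
      case (elim m)
      then have "\<kappa> * monom_size V (z + e m) \<le>
          (\<Sum>i\<in>UNIV. norm ((z + e m) $ i * partial_deriv i f (z + e m)))"
        by (intro tor) (simp add: D_def)
      then show ?case by (simp only: F_def diff_ge_0_iff_ge)
    qed
    moreover have "(\<lambda>m. F (z + e m)) \<longlonglongrightarrow> F z"
      by (rule continuous_on_tendsto_compose[OF contF lim z inD])
    ultimately show ?thesis by (intro tendsto_lowerbound[where F = sequentially]) auto
  qed
  then show ?thesis
    using \<kappa> \<delta> radius_pos unfolding V_def
    by (intro exI[of _ \<kappa>] conjI exI[of _ "min \<delta> \<rho>"]) (auto simp: D_def F_def V_def)
qed

lemma value_le_size: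
  assumes b: "\<And>i. c (axis i (b i)) \<noteq> 0" "\<And>i. b i \<le> B"
  shows "\<exists>L>0. \<forall>z. (\<forall>i. norm (z $ i) \<le> min 1 \<rho>) \<longrightarrow> norm (f z) \<le> L * monom_size (low_support c B) z"
proof -
  define V where "V = low_support c B"
  obtain K where K: "K \<ge> 0" "\<And>\<gamma> E z s. (\<forall>\<nu>. norm (\<gamma> \<nu>) \<le> real (mdeg \<nu>) + 1) \<Longrightarrow> (\<forall>i. norm (z $ i) \<le> s) \<Longrightarrow> s \<le> \<rho> \<Longrightarrow>
     ((\<lambda>\<nu>. \<gamma> \<nu> * c \<nu> * zmonom \<nu> z) has_sum E) UNIV \<Longrightarrow>
     norm (E - (\<Sum>\<nu>\<in>V. \<gamma> \<nu> * c \<nu> * zmonom \<nu> z)) \<le> K * s ^ Suc B"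
    using truncation_bound[of B] unfolding V_def by auto
  define L where "L = (\<Sum>\<nu>\<in>V. norm (c \<nu>)) + K + 1"
  have "norm (f z) \<le> L * monom_size V z" if z: "\<And>i. norm (z $ i) \<le> min 1 \<rho>" for z
  proof -
    obtain j where j: "\<And>i. norm (z $ i) \<le> norm (z $ j)" using attained_component_bound by blast
    define s where "s = norm (z $ j)"
    have s: "0 \<le> s" "s \<le> 1" "s \<le> \<rho>" using z[of j] by (auto simp: s_def)
    have "((\<lambda>\<nu>. 1 * c \<nu> * zmonom \<nu> z) has_sum f z) UNIV" using z expansion[of z] by simp
    then have "norm (f z - (\<Sum>\<nu>\<in>V. 1 * c \<nu> * zmonom \<nu> z)) \<le> K * s ^ Suc B"
      using j s by (intro K(2)) (auto simp: s_def)
    also have "\<dots> \<le> K * monom_size V z"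
    proof (rule mult_left_mono[OF _ K(1)])
      have "s ^ Suc B \<le> s ^ B" using s by (intro power_decreasing) auto
      also have "\<dots> \<le> monom_size V z"
        unfolding s_def V_def using b s by (intro component_power_le_size[of c j "b j"]) (auto simp: s_def)
      finally show "s ^ Suc B \<le> monom_size V z" .
    qed
    finally have "norm (f z - (\<Sum>\<nu>\<in>V. c \<nu> * zmonom \<nu> z)) \<le> K * monom_size V z" by simp
    moreover have "norm (\<Sum>\<nu>\<in>V. c \<nu> * zmonom \<nu> z) \<le> (\<Sum>\<nu>\<in>V. norm (c \<nu>)) * monom_size V z"
      unfolding sum_distrib_right
      by (rule sum_norm_le)
         (auto simp: norm_mult V_def finite_low_support intro!: mult_left_mono norm_zmonom_le_size)
    moreover have "norm (f z) \<le> norm (\<Sum>\<nu>\<in>V. c \<nu> * zmonom \<nu> z) + norm (f z - (\<Sum>\<nu>\<in>V. c \<nu> * zmonom \<nu> z))"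
      by (rule norm_triangle_sub)
    ultimately show ?thesis using monom_size_nonneg[of V z] by (simp add: L_def algebra_simps)
  qed
  moreover have "L > 0" using K(1) by (simp add: L_def sum_nonneg add_nonneg_pos)
  ultimately show ?thesis unfolding V_def by blast
qed

end

section \<open>The upper bound\<close>

lemma zmonom_nonzeroD: "zmonom \<nu> z \<noteq> 0 \<Longrightarrow> z $ i = 0 \<Longrightarrow> \<nu> $ i = 0"
  by (auto simp: zmonom_def)

lemma deriv_monom_nonzeroD:
  assumes "deriv_monom i \<nu> z \<noteq> 0"
  shows "\<nu> $ i \<ge> 1" "z $ i = 0 \<Longrightarrow> \<nu> $ i = 1" "k \<noteq> i \<Longrightarrow> z $ k = 0 \<Longrightarrow> \<nu> $ k = 0"
  using assms by (auto simp: deriv_monom_def power_0_left split: if_splits)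

lemma norm_partial_deriv_le_gradient: "norm (partial_deriv i f z) \<le> norm (gradient f z)"
  using Finite_Cartesian_Product.norm_nth_le[of "gradient f z" i] by (simp add: gradient_def)

context dominated_series
begin

lemma partial_deriv_at_0: "partial_deriv i f 0 = c (axis i 1)"
proof -
  have vanish: "c \<nu> * deriv_monom i \<nu> 0 = 0" if "\<nu> \<noteq> axis i 1" for \<nu>
  proof (rule ccontr)
    assume "\<not> ?thesis"
    then have "deriv_monom i \<nu> 0 \<noteq> 0" by simp
    from deriv_monom_nonzeroD[OF this] have "\<nu> = axis i 1" by (auto simp: vec_eq_iff axis_def)
    then show False using that by simp
  qed
  have "(\<Prod>j\<in>UNIV - {i}. (0 :: complex ^ 'n) $ j ^ (axis i 1 $ j)) = 1"
    by (rule prod.neutral) (auto simp: axis_def)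
  then have one: "deriv_monom i (axis i 1) 0 = 1" by (simp add: deriv_monom_def)
  have "((\<lambda>\<nu>. c \<nu> * deriv_monom i \<nu> 0) has_sum c (axis i 1)) UNIV"
    by (rule has_sum_finite_neutralI[of "{axis i 1}"]) (use vanish one in auto)
  moreover have "((\<lambda>\<nu>. c \<nu> * deriv_monom i \<nu> 0) has_sum partial_deriv i f 0) UNIV"
    by (rule has_sum_partial_deriv) (simp add: radius_pos)
  ultimately show ?thesis using has_sum_unique by blast
qed

text \<open>
  Bounding \<open>\<bar>z\<^sub>i\<bar>\<close> by \<open>M\<^bsup>1/B\<^esup>\<close> turns the estimate \<open>\<kappa> M \<le> \<Sum>\<bar>z\<^sub>i \<partial>\<^sub>i f\<bar>\<close> into
  \<open>\<kappa> M\<^bsup>1-1/B\<^esup> \<le> n \<parallel>\<partial>f\<parallel>\<close>. At the origin itself \<open>M\<close> vanishes; there the inequality is trivial unless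
  \<open>B = 1\<close>, and in that case \<open>f\<close> has a non-zero linear part.
\<close>

lemma lojasiewicz_ineq_newton:
  assumes nd: "nondegenerate c" and f0: "f 0 = 0"
    and b: "\<And>i. c (axis i (b i)) \<noteq> 0" "\<And>i. b i \<le> B" and B: "B \<ge> 1"
  shows "lojasiewicz_ineq f (1 - 1 / real B)"
proof -
  define \<theta> where "\<theta> = 1 - 1 / real B"
  have \<theta>: "0 \<le> \<theta>" using B by (simp add: \<theta>_def)
  define V where "V = low_support c B"
  define n where "n = real CARD('n)"
  have n: "n > 0" by (simp add: n_def)
  obtain \<kappa> \<delta> where \<kappa>: "\<kappa> > 0" "\<delta> > 0" and
    euler: "\<And>z. (\<forall>i. norm (z $ i) < \<delta>) \<Longrightarrow>
      \<kappa> * monom_size V z \<le> (\<Sum>i\<in>UNIV. norm (z $ i * partial_deriv i f z))"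
    unfolding V_def using euler_sum_lower_bound[of b B] nd b by blast
  obtain L where L: "L > 0" and
    val: "\<And>z. (\<forall>i. norm (z $ i) \<le> min 1 \<rho>) \<Longrightarrow> norm (f z) \<le> L * monom_size V z"
    unfolding V_def using value_le_size[of b B] b by blast
  define \<epsilon> where "\<epsilon> = Min {\<delta>, 1, \<rho>}"
  have \<epsilon>: "\<epsilon> > 0" "\<epsilon> \<le> \<delta>" "\<epsilon> \<le> 1" "\<epsilon> \<le> \<rho>" using \<kappa> radius_pos by (auto simp: \<epsilon>_def)
  let ?rhs = "\<lambda>z. if \<theta> = 0 then 1 else norm (f z) powr \<theta>"
  define C where "C = \<kappa> / (n * L powr \<theta>)"
  have C: "C > 0" using \<kappa> n L by (simp add: C_def)
  have off0: "norm (gradient f z) \<ge> C * ?rhs z" if z: "norm z < \<epsilon>" "z \<noteq> 0" for z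
  proof -
    define M where "M = monom_size V z"
    have zi: "norm (z $ i) < \<epsilon>" for i using Finite_Cartesian_Product.norm_nth_le[of z i] z by linarith
    obtain j where j: "\<And>i. norm (z $ i) \<le> norm (z $ j)" using attained_component_bound by blast
    define s where "s = norm (z $ j)"
    have "s > 0"
    proof -
      obtain i where "z $ i \<noteq> 0" using z(2) by (auto simp: vec_eq_iff)
      then show ?thesis using j[of i] by (simp add: s_def) (metis norm_le_zero_iff order_trans zero_less_norm_iff)
    qed
    have sB: "s ^ B \<le> M"
      unfolding s_def V_def M_def using b zi[of j] \<epsilon>(3) by (intro component_power_le_size[of c j "b j"]) auto
    then have M: "M > 0" using \<open>s > 0\<close> by (meson less_le_trans zero_less_power)
    have "s = (s ^ B) powr (1 / real B)"
      using \<open>s > 0\<close> B by (simp add: powr_powr flip: powr_realpow)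
    also have "\<dots> \<le> M powr (1 / real B)" using sB \<open>s > 0\<close> by (intro powr_mono2) auto
    finally have s_le: "s \<le> M powr (1 / real B)" .
    have "\<kappa> * M \<le> (\<Sum>i\<in>UNIV. norm (z $ i * partial_deriv i f z))"
      unfolding M_def using zi \<epsilon>(2) by (intro euler) (auto intro: less_le_trans)
    also have "\<dots> \<le> (\<Sum>i\<in>(UNIV :: 'n set). M powr (1 / real B) * norm (gradient f z))"
    proof (rule sum_mono)
      fix i
      show "norm (z $ i * partial_deriv i f z) \<le> M powr (1 / real B) * norm (gradient f z)"
        unfolding norm_mult using j[of i] s_le
        by (intro mult_mono norm_partial_deriv_le_gradient) (auto simp: s_def)
    qed
    also have "\<dots> = M powr (1 / real B) * (n * norm (gradient f z))" by (simp add: n_def)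
    finally have "\<kappa> * M \<le> M powr (1 / real B) * (n * norm (gradient f z))" .
    moreover have "M = M powr (1 / real B) * M powr \<theta>"
      using M by (simp add: \<theta>_def flip: powr_add)
    ultimately have "M powr (1 / real B) * (\<kappa> * M powr \<theta>) \<le> M powr (1 / real B) * (n * norm (gradient f z))"
      by (metis mult.left_commute)
    then have grad: "\<kappa> * M powr \<theta> \<le> n * norm (gradient f z)" using M by simp
    have "?rhs z \<le> L powr \<theta> * M powr \<theta>"
    proof (cases "\<theta> = 0")
      case True
      then show ?thesis using L M by simp
    next
      case False
      have "norm (f z) \<le> L * M"
        unfolding M_def using zi \<epsilon> by (intro val) (auto intro: less_imp_le order_trans)
      then have "norm (f z) powr \<theta> \<le> (L * M) powr \<theta>" using \<theta> by (intro powr_mono2) auto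
      then show ?thesis using False L M by (simp add: powr_mult)
    qed
    then have "C * ?rhs z \<le> C * (L powr \<theta> * M powr \<theta>)" using C by (intro mult_left_mono) auto
    also have "\<dots> = \<kappa> * M powr \<theta> / n" using L n by (simp add: C_def)
    also have "\<dots> \<le> norm (gradient f z)" using grad n by (simp add: divide_le_eq mult.commute)
    finally show ?thesis .
  qed
  define C' where "C' = (if \<theta> = 0 then min C (norm (gradient f 0)) else C)"
  have "C' > 0"
  proof (cases "\<theta> = 0")
    case True
    then have "B = 1" using B by (simp add: \<theta>_def)
    moreover have "b i \<ge> 1" for i using pure_power_exponent_pos[OF f0 b(1)] .
    ultimately have "b i = 1" for i using b(2)[of i] by (metis le_antisym)
    then have "partial_deriv i f 0 \<noteq> 0" for i using b(1)[of i] by (simp add: partial_deriv_at_0)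
    then have "norm (gradient f 0) > 0" by (simp add: gradient_def vec_eq_iff)
    then show ?thesis using C by (simp add: C'_def)
  qed (simp add: C'_def C)
  moreover have "norm (gradient f z) \<ge> C' * ?rhs z" if "z \<in> ball 0 \<epsilon>" for z
  proof (cases "z = 0")
    case True
    then show ?thesis by (simp add: C'_def f0)
  next
    case False
    have "C' * ?rhs z \<le> C * ?rhs z" by (intro mult_right_mono) (auto simp: C'_def)
    also have "\<dots> \<le> norm (gradient f z)" using that False by (intro off0) auto
    finally show ?thesis .
  qed
  ultimately show ?thesis
    using \<epsilon>(1) unfolding lojasiewicz_ineq_def \<theta>_def[symmetric]
    by (intro exI[of _ C'] conjI exI[of _ "ball 0 \<epsilon>"] ballI) auto
qed

section \<open>Sharpness along an axis\<close>

text \<open>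
  On the \<open>j\<close>-th axis the derivative of a monomial vanishes unless the monomial is a power of the \<open>j\<close>-th
  variable or such a power times one other variable. The hypotheses say that both kinds have degree
  at least \<open>B\<close> in the support.
\<close>

lemma gradient_on_axis_le:
  assumes min: "\<And>m. c (axis j m) \<noteq> 0 \<Longrightarrow> B \<le> m"
    and mixed: "\<And>k m. k \<noteq> j \<Longrightarrow> c (axis j m + axis k 1) \<noteq> 0 \<Longrightarrow> B \<le> m + 1" and B: "B \<ge> 1"
  shows "\<exists>K\<ge>0. \<forall>t. 0 \<le> t \<longrightarrow> t < \<rho> \<longrightarrow> norm (gradient f (axis j (of_real t))) \<le> K * t ^ (B - 1)"
proof -
  obtain K where K: "K \<ge> 0" "\<And>h S s. 0 \<le> s \<Longrightarrow> s \<le> \<rho> \<Longrightarrow> (h has_sum S) UNIV \<Longrightarrow>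
    (\<forall>\<nu>. norm (h \<nu>) \<le> (real (mdeg \<nu>) + 1) * norm (c \<nu>) * s ^ (mdeg \<nu> - 1)) \<Longrightarrow>
    (\<forall>\<nu>. mdeg \<nu> < (B - 1) + 1 \<longrightarrow> h \<nu> = 0) \<Longrightarrow> norm (S :: complex) \<le> K * s ^ (B - 1)"
    using high_order_bound[of 1 "B - 1"] by auto
  have "norm (gradient f (axis j (of_real t))) \<le> real CARD('n) * K * t ^ (B - 1)" if t: "0 \<le> t" "t < \<rho>" for t
  proof -
    define z :: "complex ^ 'n" where "z = axis j (of_real t)"
    have z: "norm (z $ i) \<le> t" for i using t by (simp add: z_def axis_def)
    have z0: "z $ i = 0" if "i \<noteq> j" for i using that by (simp add: z_def axis_def)
    have "norm (partial_deriv k f z) \<le> K * t ^ (B - 1)" for k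
    proof (rule K(2))
      show "((\<lambda>\<nu>. c \<nu> * deriv_monom k \<nu> z) has_sum partial_deriv k f z) UNIV"
        using z t by (intro has_sum_partial_deriv) (auto intro: le_less_trans)
      show "\<forall>\<nu>. norm (c \<nu> * deriv_monom k \<nu> z) \<le> (real (mdeg \<nu>) + 1) * norm (c \<nu>) * t ^ (mdeg \<nu> - 1)"
      proof
        fix \<nu>
        have "norm (deriv_monom k \<nu> z) \<le> real (mdeg \<nu>) * t ^ (mdeg \<nu> - 1)" by (rule norm_deriv_monom_le[OF z])
        also have "\<dots> \<le> (real (mdeg \<nu>) + 1) * t ^ (mdeg \<nu> - 1)" using t by (intro mult_right_mono) auto
        finally have "norm (c \<nu>) * norm (deriv_monom k \<nu> z) \<le> norm (c \<nu>) * ((real (mdeg \<nu>) + 1) * t ^ (mdeg \<nu> - 1))"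
          by (intro mult_left_mono) auto
        then show "norm (c \<nu> * deriv_monom k \<nu> z) \<le> (real (mdeg \<nu>) + 1) * norm (c \<nu>) * t ^ (mdeg \<nu> - 1)"
          by (simp add: norm_mult mult_ac)
      qed
      show "\<forall>\<nu>. mdeg \<nu> < (B - 1) + 1 \<longrightarrow> c \<nu> * deriv_monom k \<nu> z = 0"
      proof (intro allI impI, rule ccontr)
        fix \<nu> assume low: "mdeg \<nu> < (B - 1) + 1" and ne: "c \<nu> * deriv_monom k \<nu> z \<noteq> 0"
        then have c: "c \<nu> \<noteq> 0" and d: "deriv_monom k \<nu> z \<noteq> 0" by auto
        have off: "\<nu> $ i = 0" if "i \<noteq> j" "i \<noteq> k" for i
          using deriv_monom_nonzeroD(3)[OF d that(2) z0[OF that(1)]] .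
        show False
        proof (cases "k = j")
          case True
          then have eq: "\<nu> = axis j (\<nu> $ j)" using off by (simp add: vec_eq_iff axis_def)
          then have "B \<le> \<nu> $ j" using min c by metis
          moreover have "mdeg \<nu> = \<nu> $ j" using eq mdeg_axis by metis
          ultimately show False using low B by simp
        next
          case False
          then have "\<nu> $ k = 1" using deriv_monom_nonzeroD(2)[OF d] z0 by blast
          then have eq: "\<nu> = axis j (\<nu> $ j) + axis k 1"
            using off False by (auto simp: vec_eq_iff axis_def)
          then have "B \<le> \<nu> $ j + 1" using mixed[OF False] c by metis
          moreover have "mdeg \<nu> = \<nu> $ j + 1" using eq mdeg_axis mdeg_add by metis
          ultimately show False using low B by simp
        qed
      qed
    qed (use t in auto)
    then have "(\<Sum>k\<in>UNIV. norm (gradient f z $ k)) \<le> (\<Sum>k\<in>(UNIV :: 'n set). K * t ^ (B - 1))"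
      by (intro sum_mono) (simp add: gradient_def)
    then show ?thesis using norm_le_sum_components[of "gradient f z"] by (simp add: z_def mult.assoc)
  qed
  then show ?thesis using K(1) by (intro exI[of _ "real CARD('n) * K"]) auto
qed

lemma value_on_axis_asymp:
  assumes min: "\<And>m. c (axis j m) \<noteq> 0 \<Longrightarrow> B \<le> m"
  shows "\<exists>K\<ge>0. \<forall>t. 0 \<le> t \<longrightarrow> t \<le> \<rho> \<longrightarrow>
    norm (f (axis j (of_real t)) - c (axis j B) * of_real t ^ B) \<le> K * t ^ Suc B"
proof -
  obtain K where K: "K \<ge> 0" "\<And>\<gamma> E z s. (\<forall>\<nu>. norm (\<gamma> \<nu>) \<le> real (mdeg \<nu>) + 1) \<Longrightarrow> (\<forall>i. norm (z $ i) \<le> s) \<Longrightarrow> s \<le> \<rho> \<Longrightarrow>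
     ((\<lambda>\<nu>. \<gamma> \<nu> * c \<nu> * zmonom \<nu> z) has_sum E) UNIV \<Longrightarrow>
     norm (E - (\<Sum>\<nu>\<in>low_support c B. \<gamma> \<nu> * c \<nu> * zmonom \<nu> z)) \<le> K * s ^ Suc B"
    using truncation_bound[of B] by auto
  have "norm (f (axis j (of_real t)) - c (axis j B) * of_real t ^ B) \<le> K * t ^ Suc B" if t: "0 \<le> t" "t \<le> \<rho>" for t
  proof -
    define z :: "complex ^ 'n" where "z = axis j (of_real t)"
    have z: "norm (z $ i) \<le> t" for i using t by (simp add: z_def axis_def)
    have "((\<lambda>\<nu>. 1 * c \<nu> * zmonom \<nu> z) has_sum f z) UNIV"
      using expansion[of z] z t by (auto intro: order_trans)
    then have "norm (f z - (\<Sum>\<nu>\<in>low_support c B. 1 * c \<nu> * zmonom \<nu> z)) \<le> K * t ^ Suc B"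
      using z t by (intro K(2)) auto
    moreover have "(\<Sum>\<nu>\<in>low_support c B. 1 * c \<nu> * zmonom \<nu> z) =
        (\<Sum>\<nu>\<in>low_support c B. if \<nu> = axis j B then c (axis j B) * of_real t ^ B else 0)"
    proof (rule sum.cong[OF refl])
      fix \<nu> assume \<nu>: "\<nu> \<in> low_support c B"
      show "1 * c \<nu> * zmonom \<nu> z = (if \<nu> = axis j B then c (axis j B) * of_real t ^ B else 0)"
      proof (cases "\<nu> = axis j B")
        case True
        then show ?thesis by (simp add: z_def)
      next
        case False
        have "zmonom \<nu> z = 0"
        proof (rule ccontr)
          assume "zmonom \<nu> z \<noteq> 0"
          then have "\<nu> $ i = 0" if "i \<noteq> j" for i
            by (rule zmonom_nonzeroD) (use that in \<open>simp add: z_def axis_def\<close>)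
          then have eq: "\<nu> = axis j (\<nu> $ j)" by (simp add: vec_eq_iff axis_def)
          have "c (axis j (\<nu> $ j)) \<noteq> 0" using \<nu> unfolding eq[symmetric] by (simp add: low_support_def)
          then have "B \<le> \<nu> $ j" by (rule min)
          moreover have "\<nu> $ j \<le> B" using \<nu> exponent_le_mdeg[of \<nu> j] by (simp add: low_support_def)
          ultimately have "\<nu> $ j = B" by simp
          then show False using eq False by metis
        qed
        then show ?thesis using False by simp
      qed
    qed
    moreover have "\<dots> = c (axis j B) * of_real t ^ B"
      using finite_low_support[of c B] by (auto simp: low_support_def)
    ultimately show ?thesis by (simp add: z_def)
  qed
  then show ?thesis using K(1) by blast
qed

text \<open>
  Along the axis the inequality reads \<open>C (a t\<^sup>B)\<^bsup>\<theta>\<^esup> \<le> K t\<^bsup>B-1\<^esup>\<close>, which is impossible for small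
  \<open>t\<close> unless \<open>B \<theta> \<ge> B - 1\<close>.
\<close>

lemma lojasiewicz_ineq_imp_ge:
  assumes lead: "c (axis j B) \<noteq> 0" and min: "\<And>m. c (axis j m) \<noteq> 0 \<Longrightarrow> B \<le> m"
    and mixed: "\<And>k m. k \<noteq> j \<Longrightarrow> c (axis j m + axis k 1) \<noteq> 0 \<Longrightarrow> B \<le> m + 1" and B: "B \<ge> 1"
    and \<theta>: "0 \<le> \<theta>" and ineq: "lojasiewicz_ineq f \<theta>"
  shows "1 - 1 / real B \<le> \<theta>"
proof (rule ccontr)
  define e where "e = real B - 1 - real B * \<theta>"
  assume "\<not> ?thesis"
  then have "\<theta> * real B < (1 - 1 / real B) * real B" using B by (intro mult_strict_right_mono) auto
  also have "\<dots> = real B - 1" using B by (simp add: left_diff_distrib)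
  finally have "e > 0" by (simp add: e_def mult.commute)
  have "\<exists>K\<ge>0. \<forall>t. 0 \<le> t \<longrightarrow> t < \<rho> \<longrightarrow> norm (gradient f (axis j (of_real t))) \<le> K * t ^ (B - 1)"
    by (rule gradient_on_axis_le) (fact min mixed B)+
  then obtain K where K: "K \<ge> 0"
    "\<And>t. 0 \<le> t \<Longrightarrow> t < \<rho> \<Longrightarrow> norm (gradient f (axis j (of_real t))) \<le> K * t ^ (B - 1)" by blast
  have "\<exists>K\<ge>0. \<forall>t. 0 \<le> t \<longrightarrow> t \<le> \<rho> \<longrightarrow>
      norm (f (axis j (of_real t)) - c (axis j B) * of_real t ^ B) \<le> K * t ^ Suc B"
    by (rule value_on_axis_asymp) (fact min)
  then obtain K' where K': "K' \<ge> 0" "\<And>t. 0 \<le> t \<Longrightarrow> t \<le> \<rho> \<Longrightarrow>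
    norm (f (axis j (of_real t)) - c (axis j B) * of_real t ^ B) \<le> K' * t ^ Suc B" by blast
  obtain C U where C: "C > 0" and U: "open U" "0 \<in> U"
    "\<And>z. z \<in> U \<Longrightarrow> norm (gradient f z) \<ge> C * (if \<theta> = 0 then 1 else norm (f z) powr \<theta>)"
    using ineq unfolding lojasiewicz_ineq_def by blast
  obtain r where r: "r > 0" "ball 0 r \<subseteq> U" using U(1,2) openE by blast
  define a where "a = norm (c (axis j B)) / 2"
  have a: "a > 0" using lead by (simp add: a_def)
  \<comment> \<open>Below \<open>a / (K' + 1)\<close> the error \<open>K' t\<^bsup>B+1\<^esup>\<close> is at most half of the leading term \<open>2 a t\<^sup>B\<close>.\<close>
  define \<tau> where "\<tau> = Min {r, \<rho>, a / (K' + 1)}"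
  have \<tau>: "\<tau> > 0" "\<tau> \<le> r" "\<tau> \<le> \<rho>" "\<tau> \<le> a / (K' + 1)"
    using r radius_pos a K'(1) by (auto simp: \<tau>_def)
  have low: "C * a powr \<theta> \<le> K * t powr e" if t: "0 < t" "t < \<tau>" for t
  proof -
    define z :: "complex ^ 'n" where "z = axis j (of_real t)"
    have "norm z \<le> (\<Sum>i\<in>UNIV. norm (z $ i))" by (rule norm_le_sum_components)
    also have "\<dots> = t" using t by (simp add: z_def axis_def if_distrib cong: if_cong)
    finally have "z \<in> U" using r t \<tau> by auto
    have "K' * t \<le> (K' + 1) * t" using t by simp
    also have "\<dots> \<le> (K' + 1) * (a / (K' + 1))" using t \<tau> K'(1) by (intro mult_left_mono) auto
    also have "\<dots> = a" using K'(1) by simp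
    finally have "K' * t * t ^ B \<le> a * t ^ B" using t by (intro mult_right_mono) auto
    moreover have "norm (c (axis j B) * of_real t ^ B) = 2 * a * t ^ B"
      using t by (simp add: a_def norm_mult norm_power)
    moreover have "norm (c (axis j B) * of_real t ^ B) \<le> norm (f z) + norm (f z - c (axis j B) * of_real t ^ B)"
      by (metis norm_minus_commute norm_triangle_sub)
    moreover have "norm (f z - c (axis j B) * of_real t ^ B) \<le> K' * t ^ Suc B"
      unfolding z_def using t \<tau> by (intro K'(2)) auto
    ultimately have f_ge: "a * t ^ B \<le> norm (f z)" by (simp add: mult_ac)
    have pos: "a * t ^ B > 0" using a t by simp
    have "a powr \<theta> * t powr (real B * \<theta>) = (a * t ^ B) powr \<theta>"
      using a t by (simp add: powr_mult powr_powr flip: powr_realpow)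
    also have "\<dots> \<le> norm (f z) powr \<theta>" using f_ge pos \<theta> by (intro powr_mono2) auto
    also have "\<dots> = (if \<theta> = 0 then 1 else norm (f z) powr \<theta>)" using f_ge pos by auto
    finally have "C * (a powr \<theta> * t powr (real B * \<theta>)) \<le> C * (if \<theta> = 0 then 1 else norm (f z) powr \<theta>)"
      using C by (intro mult_left_mono) auto
    also have "\<dots> \<le> norm (gradient f z)" by (rule U(3)) fact
    also have "\<dots> \<le> K * t ^ (B - 1)" unfolding z_def using t \<tau> by (intro K(2)) auto
    also have "t ^ (B - 1) = t powr (real B - 1)" using t B by (simp add: of_nat_diff flip: powr_realpow)
    also have "\<dots> = t powr e * t powr (real B * \<theta>)" by (simp add: e_def flip: powr_add)
    finally have "(C * a powr \<theta>) * t powr (real B * \<theta>) \<le> (K * t powr e) * t powr (real B * \<theta>)"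
      by (simp add: mult_ac)
    then show ?thesis using t by simp
  qed
  have "((\<lambda>t. K * t powr e) \<longlongrightarrow> K * 0 powr e) (at_right 0)"
    using \<open>e > 0\<close>
    by (intro tendsto_mult tendsto_const tendsto_powr') (auto simp: eventually_at_filter)
  moreover have "\<forall>\<^sub>F t in at_right 0. C * a powr \<theta> \<le> K * t powr e"
    using eventually_at_right_real[OF \<tau>(1)] by eventually_elim (auto intro: low)
  ultimately have "C * a powr \<theta> \<le> K * 0 powr e"
    by (rule tendsto_lowerbound) simp
  moreover have "C * a powr \<theta> > 0" using C a by simp
  ultimately show False by simp
qed

end

theorem theorem20:
  fixes f :: "complex ^ 'n \<Rightarrow> complex"
    and c :: "nat ^ 'n \<Rightarrow> complex"
    and b :: "'n \<Rightarrow> nat"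
    and B :: nat
  assumes "has_power_series_at_0 f c"
    and "f 0 = 0"
    and "convenient f"
    and "nondegenerate c"
    and "\<And>j. axis j (real (b j)) \<in> newton_boundary c"
    and "B = Max (range b)"
  shows "lojasiewicz_exponent f \<le> ereal (1 - 1 / real B) \<and>
    ((\<exists>j. lojasiewicz_monomial b j \<and> \<not> exceptional_monomial c b j) \<longrightarrow>
       lojasiewicz_exponent f = ereal (1 - 1 / real B))"
proof -
  obtain \<rho> where "dominated_series f c \<rho>" using has_power_series_imp_dominated[OF assms(1)] by blast
  then interpret dominated_series f c \<rho> .
  have lead: "c (axis j (b j)) \<noteq> 0" and least: "\<And>m. c (axis j m) \<noteq> 0 \<Longrightarrow> b j \<le> m" for j
    using pure_power_on_newton_boundary[OF assms(5)[of j]] by auto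
  have le_B: "b j \<le> B" for j unfolding assms(6) by (rule Max_ge) auto
  have "b j \<ge> 1" for j using pure_power_exponent_pos[OF assms(2) lead] .
  then have B: "B \<ge> 1" using le_B by (meson le_trans)
  have "lojasiewicz_ineq f (1 - 1 / real B)"
    by (rule lojasiewicz_ineq_newton[OF assms(4,2) lead le_B B])
  then have upper: "lojasiewicz_exponent f \<le> ereal (1 - 1 / real B)"
    unfolding lojasiewicz_exponent_def using B by (intro INF_lower) auto
  moreover have "ereal (1 - 1 / real B) \<le> lojasiewicz_exponent f"
    if j: "lojasiewicz_monomial b j" "\<not> exceptional_monomial c b j" for j
  proof -
    have bj: "b j = B" using j(1) assms(6) by (simp add: lojasiewicz_monomial_def)
    have mixed: "B \<le> m + 1" if "k \<noteq> j" "c (axis j m + axis k 1) \<noteq> 0" for k m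
      using j that assms(6) unfolding exceptional_monomial_def by (metis not_le)
    have "1 - 1 / real B \<le> \<theta>" if "0 \<le> \<theta>" "lojasiewicz_ineq f \<theta>" for \<theta>
      using lojasiewicz_ineq_imp_ge[of j B \<theta>] lead[of j] least[of j] mixed B that bj by blast
    then show ?thesis
      unfolding lojasiewicz_exponent_def by (intro INF_greatest) auto
  qed
  ultimately show ?thesis by (auto intro: antisym)
qed

end
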